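(* Let $A\in\mathbb{R}^{n\times n}$, $B\in\mathbb{R}^{n\times m}$, $C\in\mathbb{R}^{m\times n}$, $D\in\mathbb{R}^{m\times m}$ be such that the state-space system $\dot x(t)=Ax(t)+Bu(t)$, $y(t)=Cx(t)+Du(t)$ is minimal, and let $$P=\begin{bmatrix} A & B\\ C & D\end{bmatrix}\in\mathbb{R}^{(n+m)\times(n+m)}$$ be its system matrix. The system can be symmetrized into a completely symmetric system if and only if the following semidefinite program is feasible: find $Q\in\mathbb{R}^{(n+m)\times(n+m)}$ subject to $$Q\succ 0,\qquad PQ=QP^\top,\qquad [I_n\;\,0]\,Q\,[0\;\,I_m]^\top=0 .$$
   Context: The transfer function of the state-space system is $G(s)=C(sI-A)^{-1}B+D$. The system is minimal if $(A,B)$ is controllable and $(A,C)$ is observable. $Q\succ 0$ means that $Q$ is symmetric positive definite. A signature matrix is a diagonal matrix whose diagonal elements are each $+1$ or $-1$. A state-space realization with system matrix $\hat P=\begin{bmatrix}\hat A&\hat B\\ \hat C&\hat D\end{bmatrix}$ ($n$ states, $m$ inputs, $m$ outputs) is (internally) symmetric if $\Sigma\hat P=\hat P^\top\Sigma$ for some signature matrix $\Sigma=\begin{bmatrix}-\Sigma_i&0\\0&\Sigma_e\end{bmatrix}$, where $\Sigma_i\in\mathbb{R}^{n\times n}$ is the internal and $\Sigma_e\in\mathbb{R}^{m\times m}$ the external signature matrix. A system is completely symmetric if it admits a minimal realization that is symmetric with $\Sigma_e=I$ and $\Sigma_i=-I$ (i.e. $\Sigma=I$, so that $\hat P=\hat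 P^\top$). The system with transfer function $G(s)$ can be symmetrized into a completely symmetric system if there is a constant invertible matrix $K\in\mathbb{R}^{m\times m}$ such that the system with transfer function $H(s)=K^{-1}G(s)K$ is completely symmetric. *)

theory Defs
  imports
    "Jordan_Normal_Form.Gauss_Jordan_Elimination"
    "Jordan_Normal_Form.DL_Rank"
    "HOL-Computational_Algebra.Polynomial_Factorial"
begin

text \<open>Matrices carry their dimensions as terms, since a minimal realization is quantified over all
  state dimensions. Systems are square: \<open>n\<close> states, \<open>m\<close> inputs and \<open>m\<close> outputs.\<close>

definition system_dims ::
    "nat \<Rightarrow> nat \<Rightarrow> real mat \<Rightarrow> real mat \<Rightarrow> real mat \<Rightarrow> real mat \<Rightarrow> bool" where
  "system_dims n m A B C D \<longleftrightarrow>
     A \<in> carrier_mat n n \<and> B \<in> carrier_mat n m \<and> C \<in> carrier_mat m n \<and> D \<in> carrier_mat m m"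

abbreviation system_matrix ::
    "real mat \<Rightarrow> real mat \<Rightarrow> real mat \<Rightarrow> real mat \<Rightarrow> real mat" where
  "system_matrix A B C D \<equiv> four_block_mat A B C D"

text \<open>The block row \<open>[B, A B, ..., A^(n-1) B]\<close> and the block column
  \<open>[C; C A; ...; C A^(n-1)]\<close>.\<close>

definition controllability_mat :: "nat \<Rightarrow> nat \<Rightarrow> real mat \<Rightarrow> real mat \<Rightarrow> real mat" where
  "controllability_mat n m A B =
     mat n (n * m) (\<lambda>(i, j). (A ^\<^sub>m (j div m) * B) $$ (i, j mod m))"

definition observability_mat :: "nat \<Rightarrow> nat \<Rightarrow> real mat \<Rightarrow> real mat \<Rightarrow> real mat" where
  "observability_mat n m A C =
     mat (n * m) n (\<lambda>(i, j). (C * A ^\<^sub>m (i div m)) $$ (i mod m, j))"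

text \<open>The first argument of \<^const>\<open>vec_space.rank\<close> is the number of rows.\<close>

definition controllable :: "nat \<Rightarrow> nat \<Rightarrow> real mat \<Rightarrow> real mat \<Rightarrow> bool" where
  "controllable n m A B \<longleftrightarrow> vec_space.rank n (controllability_mat n m A B) = n"

definition observable :: "nat \<Rightarrow> nat \<Rightarrow> real mat \<Rightarrow> real mat \<Rightarrow> bool" where
  "observable n m A C \<longleftrightarrow> vec_space.rank (n * m) (observability_mat n m A C) = n"

definition minimal_system :: "nat \<Rightarrow> nat \<Rightarrow> real mat \<Rightarrow> real mat \<Rightarrow> real mat \<Rightarrow> bool" where
  "minimal_system n m A B C \<longleftrightarrow> controllable n m A B \<and> observable n m A C"

text \<open>Transfer functions are matrices over the field of rational functions in the
  indeterminate \<open>s\<close>, so that equality is equality of rational functions.\<close>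

type_synonym ratfun = "real poly fract"

definition ratfun_s :: ratfun where
  "ratfun_s = to_fract [:0, 1:]"

definition const_mat :: "real mat \<Rightarrow> ratfun mat" where
  "const_mat M = map_mat (\<lambda>c. to_fract [:c:]) M"

text \<open>Only meaningful for invertible matrices.\<close>

definition mat_inv :: "'a :: field mat \<Rightarrow> 'a mat" where
  "mat_inv M = the (mat_inverse M)"

definition transfer_function ::
    "nat \<Rightarrow> real mat \<Rightarrow> real mat \<Rightarrow> real mat \<Rightarrow> real mat \<Rightarrow> ratfun mat" where
  "transfer_function n A B C D =
     const_mat C * mat_inv (ratfun_s \<cdot>\<^sub>m 1\<^sub>m n - const_mat A) * const_mat B + const_mat D"

definition signature_mat :: "nat \<Rightarrow> real mat \<Rightarrow> bool" where
  "signature_mat k S \<longleftrightarrow>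
     S \<in> carrier_mat k k \<and> diagonal_mat S \<and> (\<forall>i<k. S $$ (i, i) = 1 \<or> S $$ (i, i) = -1)"

definition internally_symmetric ::
    "nat \<Rightarrow> nat \<Rightarrow> real mat \<Rightarrow> real mat \<Rightarrow>
     real mat \<Rightarrow> real mat \<Rightarrow> real mat \<Rightarrow> real mat \<Rightarrow> bool" where
  "internally_symmetric n m Si Se A B C D \<longleftrightarrow>
     signature_mat n Si \<and> signature_mat m Se \<and>
     (let S = four_block_mat (- Si) (0\<^sub>m n m) (0\<^sub>m m n) Se; P = system_matrix A B C D
      in S * P = P\<^sup>T * S)"

definition completely_symmetric :: "nat \<Rightarrow> ratfun mat \<Rightarrow> bool" where
  "completely_symmetric m H \<longleftrightarrow>
     (\<exists>n A B C D. system_dims n m A B C D \<and> H = transfer_function n A B C D \<and>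
        minimal_system n m A B C \<and> internally_symmetric n m (- 1\<^sub>m n) (1\<^sub>m m) A B C D)"

definition symmetrizable :: "nat \<Rightarrow> ratfun mat \<Rightarrow> bool" where
  "symmetrizable m G \<longleftrightarrow>
     (\<exists>K \<in> carrier_mat m m. invertible_mat K \<and>
        completely_symmetric m (const_mat (mat_inv K) * G * const_mat K))"

definition sym_pos_def :: "nat \<Rightarrow> real mat \<Rightarrow> bool" where
  "sym_pos_def k Q \<longleftrightarrow>
     Q \<in> carrier_mat k k \<and> Q\<^sup>T = Q \<and>
     (\<forall>v \<in> carrier_vec k. v \<noteq> 0\<^sub>v k \<longrightarrow> v \<bullet> (Q *\<^sub>v v) > 0)"

text \<open>\<open>[M N]\<close>, for matrices with equally many rows.\<close>

definition block_row :: "real mat \<Rightarrow> real mat \<Rightarrow> real mat" where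
  "block_row M N = four_block_mat M N (0\<^sub>m 0 (dim_col M)) (0\<^sub>m 0 (dim_col N))"

definition sdp_feasible :: "nat \<Rightarrow> nat \<Rightarrow> real mat \<Rightarrow> bool" where
  "sdp_feasible n m P \<longleftrightarrow>
     (\<exists>Q \<in> carrier_mat (n + m) (n + m).
        sym_pos_def (n + m) Q \<and> P * Q = Q * P\<^sup>T \<and>
        block_row (1\<^sub>m n) (0\<^sub>m n m) * Q * (block_row (0\<^sub>m m n) (1\<^sub>m m))\<^sup>T = 0\<^sub>m n m)"

end

theory Submission
  imports Defs "Subresultants.More_Homomorphisms" "Jordan_Normal_Form.Char_Poly"
begin

text \<open>
  Both sides of the equivalence say that some block-diagonal change of coordinates
  \<open>L = diag(T, K)\<close>, acting by \<open>T\<close> on the states and by \<open>K\<close> on inputs and outputs, makes the system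
  matrix \<open>L\<^sup>-\<^sup>1 P L\<close> symmetric.

  On the side of the semidefinite program, \<open>Q = L L\<^sup>T\<close> translates between the two:
  if \<open>P L = L R\<close>, then \<open>P Q = L R L\<^sup>T\<close> and \<open>Q P\<^sup>T = L R\<^sup>T L\<^sup>T\<close>, so \<open>P Q = Q P\<^sup>T\<close> holds exactly when
  \<open>R\<close> is symmetric (\<open>congruence_symmetric_iff\<close>). The vanishing off-diagonal block of \<open>Q\<close>
  corresponds to \<open>L\<close> being block-diagonal, because each diagonal block of \<open>Q\<close> is positive definite
  and hence has a Cholesky factor of its own (\<open>sym_pos_def_cholesky\<close>).

  On the side of symmetrizability, a block-diagonal similarity turns \<open>(A, B, C, D)\<close> into a
  realization of \<open>K\<^sup>-\<^sup>1 G K\<close> and keeps it minimal (\<open>transfer_function_transform\<close>,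
  \<open>minimal_system_transform\<close>), which yields symmetrizability. Conversely, a
  symmetric minimal realization of \<open>K\<^sup>-\<^sup>1 G K\<close> may have nothing visible to do with \<open>(A, B, C, D)\<close>, but
  \<open>(A, B K, K\<^sup>-\<^sup>1 C, K\<^sup>-\<^sup>1 D K)\<close> is a minimal realization of the same transfer function. Equal
  transfer functions have equal Markov parameters \<open>D\<close> and \<open>C A\<^sup>k B\<close>
  (\<open>transfer_function_eq_imp_markov\<close>), and minimal realizations with equal Markov parameters are
  related by a state transformation \<open>T\<close> (\<open>minimal_realizations_isomorphic\<close>).
\<close>


section \<open>Ranks, kernels and one-sided inverses\<close>

text \<open>Side conditions on dimensions, unlike those on carriers, mention no intermediate size, so that
  the simplifier can discharge them for compound factors.\<close>

lemma mat_assoc: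
  fixes A :: "'a :: semiring_0 mat"
  assumes "dim_col A = dim_row B" "dim_col B = dim_row C"
  shows "A * B * C = A * (B * C)"
  using assms by (intro assoc_mult_mat[of _ "dim_row A" "dim_col A" _ "dim_col B" _ "dim_col C"]) auto

lemma mat_inverse_cancel:
  fixes S :: "'a :: semiring_1 mat"
  assumes "S * T = 1\<^sub>m n" "dim_col S = dim_row T" "dim_col T = dim_row X" "dim_row X = n"
  shows "S * (T * X) = X"
  using assms by (simp add: mat_assoc[symmetric])

lemma trivial_kernel_imp_inverse:
  fixes M :: "'a :: field mat"
  assumes M: "M \<in> carrier_mat n n"
    and ker: "\<And>v. v \<in> carrier_vec n \<Longrightarrow> M *\<^sub>v v = 0\<^sub>v n \<Longrightarrow> v = 0\<^sub>v n"
  obtains N where "N \<in> carrier_mat n n" "N * M = 1\<^sub>m n" "M * N = 1\<^sub>m n"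
proof -
  have "det M \<noteq> 0" using det_0_iff_vec_prod_zero_field[OF M] ker by blast
  from det_non_zero_imp_unit[OF M this, of undefined] show ?thesis
    using that by (auto simp: Units_def ring_mat_simps)
qed

text \<open>Over the reals \<open>v \<bullet> (M\<^sup>T M v)\<close> is the squared norm of \<open>M v\<close>. Hence the Gram matrix
  \<open>M\<^sup>T M\<close> has trivial kernel as well, and \<open>(M\<^sup>T M)\<^sup>-\<^sup>1 M\<^sup>T\<close> is the left inverse.\<close>

lemma trivial_kernel_imp_left_inverse:
  fixes M :: "real mat"
  assumes M: "M \<in> carrier_mat N n"
    and ker: "\<And>v. v \<in> carrier_vec n \<Longrightarrow> M *\<^sub>v v = 0\<^sub>v N \<Longrightarrow> v = 0\<^sub>v n"
  obtains Y where "Y \<in> carrier_mat n N" "Y * M = 1\<^sub>m n"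
proof -
  have "v = 0\<^sub>v n" if v: "v \<in> carrier_vec n" and z: "(M\<^sup>T * M) *\<^sub>v v = 0\<^sub>v n" for v
  proof (rule ker[OF v])
    have Mv: "M *\<^sub>v v \<in> carrier_vec N" using M v by simp
    have "(M *\<^sub>v v) \<bullet> (M *\<^sub>v v) = (M\<^sup>T *\<^sub>v (M *\<^sub>v v)) \<bullet> v"
      using transpose_vec_mult_scalar[OF M v Mv] by simp
    also have "M\<^sup>T *\<^sub>v (M *\<^sub>v v) = 0\<^sub>v n" using z M v by simp
    finally have "(M *\<^sub>v v) \<bullet> (M *\<^sub>v v) = 0" using v by simp
    then show "M *\<^sub>v v = 0\<^sub>v N"
      using conjugate_square_eq_0_vec[OF Mv] by simp
  qed
  moreover have "M\<^sup>T * M \<in> carrier_mat n n" using M by simp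
  ultimately obtain G where "G \<in> carrier_mat n n" "G * (M\<^sup>T * M) = 1\<^sub>m n"
    using trivial_kernel_imp_inverse by blast
  then show ?thesis using that[of "G * M\<^sup>T"] M by (simp add: mat_assoc)
qed

lemma (in vec_space) rank_le_card_cols:
  assumes "A \<in> carrier_mat n nc"
  shows "rank A \<le> card (set (cols A))"
proof -
  obtain S where S: "maximal S (\<lambda>T. T \<subseteq> set (cols A) \<and> lin_indpt T)"
    using maximal_exists_superset[of "set (cols A)" "\<lambda>T. T \<subseteq> set (cols A) \<and> lin_indpt T" "{}"]
    by (auto simp: lin_dep_def)
  then show ?thesis
    using rank_card_indpt[OF assms S] by (simp add: card_mono maximal_def)
qed

lemma full_column_rank_iff:
  fixes M :: "real mat"
  assumes M: "M \<in> carrier_mat N n"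
  shows "vec_space.rank N M = n \<longleftrightarrow>
    (\<forall>v \<in> carrier_vec n. M *\<^sub>v v = 0\<^sub>v N \<longrightarrow> v = 0\<^sub>v n)"
proof
  interpret vec_space "TYPE(real)" N .
  assume r: "rank M = n"
  then have d: "distinct (cols M)"
    using rank_le_card_cols[OF M] card_distinct card_length[of "cols M"] M
    by (metis carrier_matD(2) cols_length le_antisym)
  show "\<forall>v \<in> carrier_vec n. M *\<^sub>v v = 0\<^sub>v N \<longrightarrow> v = 0\<^sub>v n"
    using lin_depI[OF M _ _ _ d] full_rank_lin_indpt[OF M r d] by blast
next
  interpret vec_space "TYPE(real)" N .
  assume ker: "\<forall>v \<in> carrier_vec n. M *\<^sub>v v = 0\<^sub>v N \<longrightarrow> v = 0\<^sub>v n"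
  then obtain Y where Y: "Y \<in> carrier_mat n N" "Y * M = 1\<^sub>m n"
    using trivial_kernel_imp_left_inverse[OF M] by blast
  have "distinct (cols M)"
  proof (unfold distinct_conv_nth, intro allI impI)
    fix i j assume ij: "i < length (cols M)" "j < length (cols M)" "i \<noteq> j"
    have "Y *\<^sub>v col M k = unit_vec n k" if "k < n" for k
      using that M Y col_mult2[OF Y(1) M that] by simp
    then show "cols M ! i \<noteq> cols M ! j"
      using ij M by (metis carrier_matD(2) cols_length cols_nth unit_vec_eq)
  qed
  then show "rank M = n"
    using lin_indpt_full_rank[OF M] lin_depE[OF M] ker by metis
qed

text \<open>A vector killed by \<open>M\<^sup>T\<close> is orthogonal to the columns of \<open>M\<close>, hence to a basis chosen among
  them if the rank is full. Conversely, a right inverse of \<open>M\<close> exhibits every vector as a combination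
  of columns.\<close>

lemma full_row_rank_iff:
  fixes M :: "real mat"
  assumes M: "M \<in> carrier_mat n N"
  shows "vec_space.rank n M = n \<longleftrightarrow>
    (\<forall>w \<in> carrier_vec n. M\<^sup>T *\<^sub>v w = 0\<^sub>v N \<longrightarrow> w = 0\<^sub>v n)"
proof
  interpret vec_space "TYPE(real)" n .
  assume r: "rank M = n"
  obtain S where S: "finite S" "maximal S (\<lambda>T. T \<subseteq> set (cols M) \<and> lin_indpt T)"
    using maximal_exists_superset[of "set (cols M)" "\<lambda>T. T \<subseteq> set (cols M) \<and> lin_indpt T" "{}"]
    by (auto simp: lin_dep_def)
  have Sc: "card S = n" "S \<subseteq> set (cols M)" "lin_indpt S"
    using S rank_card_indpt[OF M S(2)] r by (auto simp: maximal_def)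
  obtain xs where xs: "set xs = S" "distinct xs" using S(1) finite_distinct_list by blast
  have len: "length xs = n" using xs Sc(1) distinct_card by fastforce
  have xc: "set xs \<subseteq> carrier_vec n" using xs Sc(2) M cols_dim[of M] by auto
  define W where "W = mat_of_cols n xs"
  have W: "W \<in> carrier_mat n n" by (simp add: W_def len[symmetric])
  have cW: "cols W = xs" using xc by (simp add: W_def)
  have "rank W = n" using lin_indpt_full_rank[OF W] xs Sc(3) cW by simp
  then have "det W\<^sup>T \<noteq> 0" using det_rank_iff[OF W] det_transpose[OF W] by simp
  then have kW: "W\<^sup>T *\<^sub>v w = 0\<^sub>v n \<Longrightarrow> w = 0\<^sub>v n" if "w \<in> carrier_vec n" for w
    using det_0_iff_vec_prod_zero_field[of "W\<^sup>T" n] W that by auto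
  show "\<forall>w \<in> carrier_vec n. M\<^sup>T *\<^sub>v w = 0\<^sub>v N \<longrightarrow> w = 0\<^sub>v n"
  proof (intro ballI impI)
    fix w assume w: "w \<in> carrier_vec n" and z: "M\<^sup>T *\<^sub>v w = 0\<^sub>v N"
    have orth: "c \<bullet> w = 0" if "c \<in> set (cols M)" for c
    proof -
      from that obtain j where j: "j < N" "c = col M j"
        using M by (auto simp: in_set_conv_nth)
      have "(M\<^sup>T *\<^sub>v w) $ j = c \<bullet> w" using j M by simp
      then show ?thesis using z j by simp
    qed
    have "W\<^sup>T *\<^sub>v w = 0\<^sub>v n"
    proof (rule eq_vecI)
      fix i assume i: "i < dim_vec (0\<^sub>v n :: real vec)"
      then have "(W\<^sup>T *\<^sub>v w) $ i = xs ! i \<bullet> w"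
        using W cW len by (simp add: cols_nth[symmetric])
      also have "xs ! i \<in> set (cols M)" using i len xs Sc(2) nth_mem by auto
      then have "xs ! i \<bullet> w = 0" by (rule orth)
      finally show "(W\<^sup>T *\<^sub>v w) $ i = 0\<^sub>v n $ i" using i by simp
    qed (use W in simp)
    then show "w = 0\<^sub>v n" by (rule kW[OF w])
  qed
next
  interpret vec_space "TYPE(real)" n .
  assume ker: "\<forall>w \<in> carrier_vec n. M\<^sup>T *\<^sub>v w = 0\<^sub>v N \<longrightarrow> w = 0\<^sub>v n"
  have Mt: "M\<^sup>T \<in> carrier_mat N n" using M by simp
  from trivial_kernel_imp_left_inverse[OF Mt] ker obtain Y
    where Y: "Y \<in> carrier_mat n N" "Y * M\<^sup>T = 1\<^sub>m n" by blast
  have "(Y * M\<^sup>T)\<^sup>T = M * Y\<^sup>T" using transpose_mult[OF Y(1) Mt] by simp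
  then have X: "M * Y\<^sup>T = 1\<^sub>m n" using Y by simp
  have "v \<in> span (set (cols M))" if v: "v \<in> carrier_vec n" for v
  proof -
    have "M *\<^sub>v (Y\<^sup>T *\<^sub>v v) = v" using X v M Y by (subst assoc_mult_mat_vec[symmetric]) auto
    moreover have "Y\<^sup>T *\<^sub>v v \<in> carrier_vec N" using Y v by simp
    ultimately show ?thesis
      using col_space_eq[OF M] M v unfolding col_space_def by auto
  qed
  moreover have "span (set (cols M)) \<subseteq> carrier_vec n"
    using span_is_subset2[of "set (cols M)"] cols_dim[of M] M by auto
  ultimately have "span (set (cols M)) = carrier_vec n" by blast
  then show "rank M = n"
    unfolding rank_def using dim_is_n by (simp add: module_vec_def)
qed


section \<open>Controllability and observability without ranks\<close>

text \<open>Stacking an arbitrary sequence of blocks, with a number of blocks independent of their width,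
  allows the observability matrices of two realizations to be compared at equal height before their
  state dimensions are known to agree.\<close>

definition row_stack :: "nat \<Rightarrow> nat \<Rightarrow> nat \<Rightarrow> (nat \<Rightarrow> 'a mat) \<Rightarrow> 'a mat" where
  "row_stack N m n F = mat (N * m) n (\<lambda>(i, j). F (i div m) $$ (i mod m, j))"

lemma row_stack_carrier [simp]: "row_stack N m n F \<in> carrier_mat (N * m) n"
  by (simp add: row_stack_def)

lemma block_index:
  assumes "i < N * (m :: nat)"
  shows "i div m < N" "i mod m < m"
  using assms by (simp_all add: less_mult_imp_div_less) (metis mod_less_divisor mult_0_right not_less_zero neq0_conv)

lemma row_stack_cong:
  assumes "\<And>k. k < N \<Longrightarrow> F k = G k"
  shows "row_stack N m n F = row_stack N m n G"
  using assms by (auto simp: row_stack_def block_index)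

lemma row_stack_mult:
  fixes X :: "'a :: semiring_0 mat"
  assumes F: "\<And>k. k < N \<Longrightarrow> F k \<in> carrier_mat m n" and X: "X \<in> carrier_mat n p"
  shows "row_stack N m n F * X = row_stack N m p (\<lambda>k. F k * X)"
proof (rule eq_matI)
  fix i j
  assume "i < dim_row (row_stack N m p (\<lambda>k. F k * X))" "j < dim_col (row_stack N m p (\<lambda>k. F k * X))"
  then have i: "i < N * m" and j: "j < p" by (simp_all add: row_stack_def)
  note b = block_index[OF i]
  have "row (row_stack N m n F) i = row (F (i div m)) (i mod m)"
    using F[OF b(1)] b i by (intro eq_vecI) (auto simp: row_stack_def)
  then show "(row_stack N m n F * X) $$ (i, j) = row_stack N m p (\<lambda>k. F k * X) $$ (i, j)"
    using F[OF b(1)] b i j X by (simp add: row_stack_def)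
qed (use X in \<open>simp_all add: row_stack_def\<close>)

lemma row_stack_kernel:
  fixes v :: "'a :: semiring_0 vec"
  assumes F: "\<And>k. k < N \<Longrightarrow> F k \<in> carrier_mat m n" and v: "v \<in> carrier_vec n"
  shows "row_stack N m n F *\<^sub>v v = 0\<^sub>v (N * m) \<longleftrightarrow> (\<forall>k<N. F k *\<^sub>v v = 0\<^sub>v m)"
proof -
  have entry: "(row_stack N m n F *\<^sub>v v) $ i = (F (i div m) *\<^sub>v v) $ (i mod m)" if i: "i < N * m" for i
  proof -
    note b = block_index[OF i]
    have "row (row_stack N m n F) i = row (F (i div m)) (i mod m)"
      using F[OF b(1)] b i by (intro eq_vecI) (auto simp: row_stack_def)
    then show ?thesis using F[OF b(1)] b i by (simp add: row_stack_def)
  qed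
  show ?thesis
  proof
    assume z: "row_stack N m n F *\<^sub>v v = 0\<^sub>v (N * m)"
    show "\<forall>k<N. F k *\<^sub>v v = 0\<^sub>v m"
    proof (intro allI impI eq_vecI)
      fix k r assume k: "k < N" and "r < dim_vec (0\<^sub>v m :: 'a vec)"
      then have r: "r < m" by simp
      have "k * m + r < Suc k * m" using r by simp
      also have "\<dots> \<le> N * m" using k by (intro mult_le_mono1) simp
      finally have "k * m + r < N * m" .
      from entry[OF this] show "(F k *\<^sub>v v) $ r = 0\<^sub>v m $ r"
        using z r \<open>k * m + r < N * m\<close> by simp
    next
      fix k assume k: "k < N" show "dim_vec (F k *\<^sub>v v) = dim_vec (0\<^sub>v m :: 'a vec)"
        using F[OF k] by simp
    qed
  next
    assume "\<forall>k<N. F k *\<^sub>v v = 0\<^sub>v m"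
    then show "row_stack N m n F *\<^sub>v v = 0\<^sub>v (N * m)"
      by (intro eq_vecI) (auto simp: entry block_index carrier_matD[OF row_stack_carrier] simp del: index_mult_mat_vec)
  qed
qed

definition col_stack :: "nat \<Rightarrow> nat \<Rightarrow> nat \<Rightarrow> (nat \<Rightarrow> 'a mat) \<Rightarrow> 'a mat" where
  "col_stack N m n F = (row_stack N m n (\<lambda>k. (F k)\<^sup>T))\<^sup>T"

lemma col_stack_carrier [simp]: "col_stack N m n F \<in> carrier_mat n (N * m)"
  by (simp add: col_stack_def)

lemma mult_col_stack:
  fixes X :: "'a :: comm_semiring_0 mat"
  assumes F: "\<And>k. k < N \<Longrightarrow> F k \<in> carrier_mat n m" and X: "X \<in> carrier_mat p n"
  shows "X * col_stack N m n F = col_stack N m p (\<lambda>k. X * F k)"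
proof -
  have "X * col_stack N m n F = (row_stack N m n (\<lambda>k. (F k)\<^sup>T) * X\<^sup>T)\<^sup>T"
    using X by (subst transpose_mult[where nr = "N * m"]) (auto simp: col_stack_def)
  also have "row_stack N m n (\<lambda>k. (F k)\<^sup>T) * X\<^sup>T = row_stack N m p (\<lambda>k. (F k)\<^sup>T * X\<^sup>T)"
    using F X by (intro row_stack_mult) auto
  also have "\<dots> = row_stack N m p (\<lambda>k. (X * F k)\<^sup>T)"
    using F X by (intro row_stack_cong) (simp add: transpose_mult[OF X F])
  finally show ?thesis by (simp add: col_stack_def)
qed

lemma mat_pow_Suc_left:
  fixes A :: "'a :: semiring_1 mat"
  assumes "A \<in> carrier_mat n n"
  shows "A * A ^\<^sub>m k = A ^\<^sub>m Suc k"
proof (induction k)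
  case (Suc k)
  have "A * A ^\<^sub>m Suc k = (A * A ^\<^sub>m k) * A" using assms by (simp add: mat_assoc)
  with Suc show ?case by simp
qed (use assms in simp)

lemma pow_mult_carrier [simp]:
  fixes A :: "'a :: semiring_1 mat"
  assumes "A \<in> carrier_mat n n" "B \<in> carrier_mat n m"
  shows "A ^\<^sub>m k * B \<in> carrier_mat n m"
  by (intro mult_carrier_mat[OF pow_carrier_mat] assms)

lemma observable_iff:
  assumes A: "A \<in> carrier_mat n n" and C: "C \<in> carrier_mat m n"
  shows "observable n m A C \<longleftrightarrow>
    (\<forall>v \<in> carrier_vec n. (\<forall>k<n. (C * A ^\<^sub>m k) *\<^sub>v v = 0\<^sub>v m) \<longrightarrow> v = 0\<^sub>v n)"
proof -
  have "observability_mat n m A C = row_stack n m n (\<lambda>k. C * A ^\<^sub>m k)"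
    by (simp add: observability_mat_def row_stack_def)
  moreover have "C * A ^\<^sub>m k \<in> carrier_mat m n" for k using A C by simp
  ultimately show ?thesis
    unfolding observable_def
    using full_column_rank_iff[OF row_stack_carrier[of n m n "\<lambda>k. C * A ^\<^sub>m k"]]
      row_stack_kernel[of n "\<lambda>k. C * A ^\<^sub>m k" m n]
    by simp
qed

lemma controllable_iff:
  assumes A: "A \<in> carrier_mat n n" and B: "B \<in> carrier_mat n m"
  shows "controllable n m A B \<longleftrightarrow>
    (\<forall>w \<in> carrier_vec n. (\<forall>k<n. (A ^\<^sub>m k * B)\<^sup>T *\<^sub>v w = 0\<^sub>v m) \<longrightarrow> w = 0\<^sub>v n)"
proof -
  have c: "A ^\<^sub>m k * B \<in> carrier_mat n m" for k using A B by simp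
  have "controllability_mat n m A B = col_stack n m n (\<lambda>k. A ^\<^sub>m k * B)"
    using A B by (intro eq_matI) (auto simp: controllability_mat_def col_stack_def row_stack_def block_index)
  then show ?thesis
    unfolding controllable_def
    using full_row_rank_iff[OF col_stack_carrier[of n m n "\<lambda>k. A ^\<^sub>m k * B"]] c
      row_stack_kernel[of n "\<lambda>k. (A ^\<^sub>m k * B)\<^sup>T" m n]
    by (simp add: col_stack_def)
qed

lemma observable_left_inverse:
  assumes A: "A \<in> carrier_mat n n" and C: "C \<in> carrier_mat m n" and obs: "observable n m A C"
  obtains Y where "Y \<in> carrier_mat n (n * m)" "Y * row_stack n m n (\<lambda>k. C * A ^\<^sub>m k) = 1\<^sub>m n"
proof -
  have c: "C * A ^\<^sub>m k \<in> carrier_mat m n" for k using A C by simp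
  show ?thesis
    using trivial_kernel_imp_left_inverse[OF row_stack_carrier[of n m n "\<lambda>k. C * A ^\<^sub>m k"]] that
      row_stack_kernel[of n "\<lambda>k. C * A ^\<^sub>m k" m n, OF c] obs[unfolded observable_iff[OF A C]]
    by metis
qed

lemma controllable_right_inverse:
  assumes A: "A \<in> carrier_mat n n" and B: "B \<in> carrier_mat n m" and con: "controllable n m A B"
  obtains X where "X \<in> carrier_mat (n * m) n" "col_stack n m n (\<lambda>k. A ^\<^sub>m k * B) * X = 1\<^sub>m n"
proof -
  let ?R = "row_stack n m n (\<lambda>k. (A ^\<^sub>m k * B)\<^sup>T)"
  have c: "(A ^\<^sub>m k * B)\<^sup>T \<in> carrier_mat m n" for k using A B by simp
  obtain Y where Y: "Y \<in> carrier_mat n (n * m)" "Y * ?R = 1\<^sub>m n"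
    using trivial_kernel_imp_left_inverse[OF row_stack_carrier[of n m n "\<lambda>k. (A ^\<^sub>m k * B)\<^sup>T"]]
      row_stack_kernel[of n "\<lambda>k. (A ^\<^sub>m k * B)\<^sup>T" m n, OF c] con[unfolded controllable_iff[OF A B]]
    by metis
  have "?R\<^sup>T * Y\<^sup>T = 1\<^sub>m n"
    using transpose_mult[OF Y(1) row_stack_carrier] Y(2) by (metis transpose_one)
  then show ?thesis using that[of "Y\<^sup>T"] Y(1) by (simp add: col_stack_def)
qed


section \<open>Uniqueness of minimal realizations\<close>

text \<open>A controllable pair reaches every state, so a linear map is determined by its values on the
  columns of \<open>A\<^sup>k B\<close>.\<close>

lemma controllable_cancel:
  assumes A: "A \<in> carrier_mat n n" and B: "B \<in> carrier_mat n m" and con: "controllable n m A B"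
    and S: "S \<in> carrier_mat p n" and T: "T \<in> carrier_mat p n"
    and eq: "\<And>k. S * (A ^\<^sub>m k * B) = T * (A ^\<^sub>m k * B)"
  shows "S = T"
proof -
  obtain X where X: "X \<in> carrier_mat (n * m) n" "col_stack n m n (\<lambda>k. A ^\<^sub>m k * B) * X = 1\<^sub>m n"
    using controllable_right_inverse[OF A B con] .
  let ?R = "col_stack n m n (\<lambda>k. A ^\<^sub>m k * B)"
  have "S * ?R = T * ?R"
    using mult_col_stack[of n "\<lambda>k. A ^\<^sub>m k * B" n m, OF _ S]
      mult_col_stack[of n "\<lambda>k. A ^\<^sub>m k * B" n m, OF _ T] A B eq by simp
  then have "S * ?R * X = T * ?R * X" by simp
  then show ?thesis using X S T by (simp add: mat_assoc carrier_matD[OF col_stack_carrier])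
qed

text \<open>The map \<open>T\<close> reads off the outputs that a state of the first system produces and finds the
  state of the second system with the same outputs: \<open>T = Y O\<close>, where \<open>O\<close> is the observability matrix of
  the first system and \<open>Y\<close> a left inverse of that of the second. Equality of the Hankel matrices
  \<open>C A\<^sup>i A\<^sup>k B\<close> also gives \<open>T = R' X\<close> with the reachability matrix \<open>R'\<close> of the second system and a
  right inverse \<open>X\<close> of that of the first; each form of \<open>T\<close> yields one of the two intertwining relations.\<close>

lemma intertwiner_exists:
  assumes A: "A \<in> carrier_mat n n" and B: "B \<in> carrier_mat n m" and C: "C \<in> carrier_mat m n"
    and A': "A' \<in> carrier_mat n' n'" and B': "B' \<in> carrier_mat n' m" and C': "C' \<in> carrier_mat m n'"
    and con: "controllable n m A B" and obs: "observable n' m A' C'"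
    and markov: "\<And>k. C * A ^\<^sub>m k * B = C' * A' ^\<^sub>m k * B'"
  obtains T where "T \<in> carrier_mat n' n"
    "\<And>k. T * (A ^\<^sub>m k * B) = A' ^\<^sub>m k * B'" "\<And>k. C' * A' ^\<^sub>m k * T = C * A ^\<^sub>m k"
proof -
  note car = A B C A' B' C'
  let ?O = "row_stack n' m n (\<lambda>k. C * A ^\<^sub>m k)" and ?O' = "row_stack n' m n' (\<lambda>k. C' * A' ^\<^sub>m k)"
  let ?R = "col_stack n m n (\<lambda>k. A ^\<^sub>m k * B)" and ?R' = "col_stack n m n' (\<lambda>k. A' ^\<^sub>m k * B')"
  obtain Y where Y: "Y \<in> carrier_mat n' (n' * m)" "Y * ?O' = 1\<^sub>m n'"
    using observable_left_inverse[OF A' C' obs] .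
  obtain X where X: "X \<in> carrier_mat (n * m) n" "?R * X = 1\<^sub>m n"
    using controllable_right_inverse[OF A B con] .
  have pow_add: "M ^\<^sub>m i * M ^\<^sub>m k = M ^\<^sub>m (i + k)" if "M \<in> carrier_mat p p" for M :: "real mat" and p i k
  proof (induction k)
    case (Suc k)
    then show ?case using that by (simp add: mat_assoc[symmetric])
  qed (use that in simp)
  have hankel: "C * A ^\<^sub>m i * (A ^\<^sub>m k * B) = C' * A' ^\<^sub>m i * (A' ^\<^sub>m k * B')" for i k
  proof -
    have "C * A ^\<^sub>m i * (A ^\<^sub>m k * B) = C * (A ^\<^sub>m i * A ^\<^sub>m k) * B"
      using car by (simp add: mat_assoc)
    also have "\<dots> = C' * (A' ^\<^sub>m i * A' ^\<^sub>m k) * B'"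
      by (simp only: pow_add[OF A] pow_add[OF A'] markov)
    also have "\<dots> = C' * A' ^\<^sub>m i * (A' ^\<^sub>m k * B')"
      using car by (simp add: mat_assoc)
    finally show ?thesis .
  qed
  define T where "T = Y * ?O"
  have T: "T \<in> carrier_mat n' n" using Y by (simp add: T_def mult_carrier_mat[OF _ row_stack_carrier])
  have OO': "?O * (A ^\<^sub>m k * B) = ?O' * (A' ^\<^sub>m k * B')" for k
  proof -
    have "?O * (A ^\<^sub>m k * B) = row_stack n' m m (\<lambda>i. C * A ^\<^sub>m i * (A ^\<^sub>m k * B))"
      using car by (intro row_stack_mult) auto
    also have "\<dots> = row_stack n' m m (\<lambda>i. C' * A' ^\<^sub>m i * (A' ^\<^sub>m k * B'))"
      by (simp only: hankel)
    also have "\<dots> = ?O' * (A' ^\<^sub>m k * B')"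
      using car by (intro row_stack_mult[symmetric]) auto
    finally show ?thesis .
  qed
  have TB: "T * (A ^\<^sub>m k * B) = A' ^\<^sub>m k * B'" for k
  proof -
    have "T * (A ^\<^sub>m k * B) = Y * (?O' * (A' ^\<^sub>m k * B'))"
      unfolding T_def using car Y by (subst mat_assoc) (simp_all add: OO' carrier_matD[OF row_stack_carrier])
    also have "\<dots> = A' ^\<^sub>m k * B'"
      using car Y by (intro mat_inverse_cancel) (auto simp: carrier_matD[OF row_stack_carrier])
    finally show ?thesis .
  qed
  have "T * ?R = ?R'"
    using car T by (subst mult_col_stack[where p = n']) (auto simp: TB)
  then have "T * ?R * X = ?R' * X" by simp
  then have TX: "T = ?R' * X"
    using T X by (simp add: mat_assoc carrier_matD[OF col_stack_carrier])
  have CT: "C' * A' ^\<^sub>m k * T = C * A ^\<^sub>m k" for k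
  proof -
    have "C' * A' ^\<^sub>m k * ?R' = C * A ^\<^sub>m k * ?R"
      using car by (subst (1 2) mult_col_stack[where p = m]) (auto simp: hankel)
    then have "C' * A' ^\<^sub>m k * T = C * A ^\<^sub>m k * ?R * X"
      unfolding TX using car X by (subst mat_assoc[symmetric]) (simp_all add: carrier_matD[OF col_stack_carrier])
    also have "\<dots> = C * A ^\<^sub>m k"
      using car X by (subst mat_assoc) (auto simp: carrier_matD[OF col_stack_carrier])
    finally show ?thesis .
  qed
  show ?thesis using that[OF T TB CT] .
qed

text \<open>The intertwiners in the two directions compose to maps that fix all \<open>A\<^sup>k B\<close>, so they are mutually
  inverse.\<close>

lemma minimal_realizations_isomorphic:
  assumes A: "A \<in> carrier_mat n n" and B: "B \<in> carrier_mat n m" and C: "C \<in> carrier_mat m n"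
    and A': "A' \<in> carrier_mat n' n'" and B': "B' \<in> carrier_mat n' m" and C': "C' \<in> carrier_mat m n'"
    and min: "minimal_system n m A B C" and min': "minimal_system n' m A' B' C'"
    and markov: "\<And>k. C * A ^\<^sub>m k * B = C' * A' ^\<^sub>m k * B'"
  obtains S T where "n' = n" "S \<in> carrier_mat n n" "T \<in> carrier_mat n n"
    "S * T = 1\<^sub>m n" "T * S = 1\<^sub>m n" "A * T = T * A'" "B = T * B'" "C * T = C'"
proof -
  note car = A B C A' B' C'
  have con: "controllable n m A B" "controllable n' m A' B'"
    and obs: "observable n m A C" "observable n' m A' C'"
    using min min' by (auto simp: minimal_system_def)
  obtain S where S: "S \<in> carrier_mat n' n"
    and SB: "\<And>k. S * (A ^\<^sub>m k * B) = A' ^\<^sub>m k * B'" and CS: "\<And>k. C' * A' ^\<^sub>m k * S = C * A ^\<^sub>m k"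
    using intertwiner_exists[OF car con(1) obs(2) markov] by blast
  obtain T where T: "T \<in> carrier_mat n n'"
    and TB: "\<And>k. T * (A' ^\<^sub>m k * B') = A ^\<^sub>m k * B" and CT: "\<And>k. C * A ^\<^sub>m k * T = C' * A' ^\<^sub>m k"
    using intertwiner_exists[OF A' B' C' A B C con(2) obs(1) markov[symmetric]] by blast
  have TS: "T * S = 1\<^sub>m n"
  proof (rule controllable_cancel[OF A B con(1)])
    fix k
    have "T * S * (A ^\<^sub>m k * B) = T * (S * (A ^\<^sub>m k * B))"
      using car S T by (subst mat_assoc) auto
    then show "T * S * (A ^\<^sub>m k * B) = 1\<^sub>m n * (A ^\<^sub>m k * B)"
      using car by (simp add: SB TB)
  qed (use S T in auto)
  have ST: "S * T = 1\<^sub>m n'"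
  proof (rule controllable_cancel[OF A' B' con(2)])
    fix k
    have "S * T * (A' ^\<^sub>m k * B') = S * (T * (A' ^\<^sub>m k * B'))"
      using car S T by (subst mat_assoc) auto
    then show "S * T * (A' ^\<^sub>m k * B') = 1\<^sub>m n' * (A' ^\<^sub>m k * B')"
      using car by (simp add: SB TB)
  qed (use S T in auto)
  have AT: "A * T = T * A'"
  proof (rule controllable_cancel[OF A' B' con(2)])
    fix k
    have "A * T * (A' ^\<^sub>m k * B') = A * (T * (A' ^\<^sub>m k * B'))"
      using car T by (subst mat_assoc) auto
    also have "\<dots> = A * A ^\<^sub>m k * B"
      unfolding TB using car by (subst mat_assoc) auto
    also have "\<dots> = T * (A' ^\<^sub>m Suc k * B')"
      by (simp only: TB mat_pow_Suc_left[OF A])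
    also have "\<dots> = T * (A' * A' ^\<^sub>m k * B')"
      by (simp only: mat_pow_Suc_left[OF A'])
    also have "\<dots> = T * A' * (A' ^\<^sub>m k * B')"
      using car T by (simp add: mat_assoc)
    finally show "A * T * (A' ^\<^sub>m k * B') = T * A' * (A' ^\<^sub>m k * B')" .
  qed (use car T in auto)
  \<comment> \<open>the trace of a product does not depend on the order of its factors\<close>
  have "n' = n"
  proof -
    have "(\<Sum>i<n. \<Sum>j<n'. T $$ (i, j) * S $$ (j, i)) = (\<Sum>i<n. (T * S) $$ (i, i))"
      using S T by (intro sum.cong) (auto simp: scalar_prod_def atLeast0LessThan)
    also have "\<dots> = real n" unfolding TS by simp
    finally have "(\<Sum>i<n. \<Sum>j<n'. T $$ (i, j) * S $$ (j, i)) = real n" .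
    moreover have "(\<Sum>j<n'. \<Sum>i<n. S $$ (j, i) * T $$ (i, j)) = (\<Sum>j<n'. (S * T) $$ (j, j))"
      using S T by (intro sum.cong) (auto simp: scalar_prod_def atLeast0LessThan)
    then have "(\<Sum>j<n'. \<Sum>i<n. S $$ (j, i) * T $$ (i, j)) = real n'" unfolding ST by simp
    ultimately show ?thesis
      by (subst (asm) sum.swap) (simp add: mult.commute)
  qed
  moreover have "B = T * B'" "C * T = C'"
    using TB[of 0] CT[of 0] car by auto
  ultimately show ?thesis using that[of S T] S T ST TS AT by simp
qed


section \<open>Transfer functions determine Markov parameters\<close>

text \<open>Strictly proper rational functions play the part of functions vanishing at infinity: they absorb
  constant factors, are closed under sums and contain no constant but zero. The strict inequality of
  degrees already forces \<open>q \<noteq> 0\<close>.\<close>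

definition strictly_proper :: "ratfun \<Rightarrow> bool" where
  "strictly_proper x \<longleftrightarrow> (\<exists>p q. degree p < degree q \<and> x = to_fract p / to_fract q)"

lemma strictly_proper_0 [simp]: "strictly_proper 0"
  unfolding strictly_proper_def by (rule exI[of _ 0], rule exI[of _ "[:0, 1:]"]) simp

lemma strictly_proper_add:
  assumes "strictly_proper x" "strictly_proper y"
  shows "strictly_proper (x + y)"
proof -
  obtain p q p' q' where x: "degree p < degree q" "x = to_fract p / to_fract q"
    and y: "degree p' < degree q'" "y = to_fract p' / to_fract q'"
    using assms unfolding strictly_proper_def by blast
  have nz: "q \<noteq> 0" "q' \<noteq> 0" using x(1) y(1) by auto
  have "degree (p * q') < degree q + degree q'" "degree (p' * q) < degree q + degree q'"
    using degree_mult_le[of p q'] degree_mult_le[of p' q] x(1) y(1) by linarith+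
  then have "degree (p * q' + p' * q) < degree (q * q')"
    using nz by (simp add: degree_mult_eq degree_add_less)
  moreover have "x + y = to_fract (p * q' + p' * q) / to_fract (q * q')"
    using nz x y by (simp add: add_frac_eq)
  ultimately show ?thesis unfolding strictly_proper_def by blast
qed

lemma strictly_proper_const_mult:
  assumes "strictly_proper x"
  shows "strictly_proper (to_fract [:c:] * x)"
proof -
  obtain p q where x: "degree p < degree q" "x = to_fract p / to_fract q"
    using assms unfolding strictly_proper_def by blast
  have "degree (smult c p) < degree q" using x(1) degree_smult_le[of c p] by linarith
  moreover have "to_fract [:c:] * x = to_fract (smult c p) / to_fract q"
    unfolding x(2) times_divide_eq_right to_fract_hom.hom_mult[symmetric] by simp
  ultimately show ?thesis unfolding strictly_proper_def by blast
qed

lemma strictly_proper_sum: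
  assumes "\<And>i. i \<in> I \<Longrightarrow> strictly_proper (f i)"
  shows "strictly_proper (sum f I)"
  using assms by (induction I rule: infinite_finite_induct) (auto intro: strictly_proper_add)

lemma strictly_proper_const_iff: "strictly_proper (to_fract [:c:]) \<longleftrightarrow> c = 0"
proof
  assume "strictly_proper (to_fract [:c:])"
  then obtain p q where x: "degree p < degree q" "to_fract [:c:] = to_fract p / to_fract q"
    unfolding strictly_proper_def by blast
  have "to_fract q \<noteq> (0 :: ratfun)" using x(1) by auto
  with x(2) have "to_fract ([:c:] * q) = to_fract p"
    unfolding to_fract_hom.hom_mult by (simp add: field_simps)
  then have "[:c:] * q = p" by (simp only: to_fract_hom.eq_iff)
  then show "c = 0" using x(1) by (cases "c = 0") (auto simp: degree_mult_eq)
qed simp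

interpretation const_hom: comm_ring_hom "\<lambda>c :: real. to_fract [:c:]"
  by unfold_locales (simp_all add: one_pCons[symmetric] flip: to_fract_add to_fract_mult)

lemma const_mat_carrier [simp]: "const_mat M \<in> carrier_mat r c \<longleftrightarrow> M \<in> carrier_mat r c"
  by (simp add: const_mat_def)

lemma const_mat_dim [simp]: "dim_row (const_mat M) = dim_row M" "dim_col (const_mat M) = dim_col M"
  by (simp_all add: const_mat_def)

lemma const_mat_mult:
  assumes "M \<in> carrier_mat r k" "N \<in> carrier_mat k c"
  shows "const_mat (M * N) = const_mat M * const_mat N"
  unfolding const_mat_def by (rule const_hom.mat_hom_mult[OF assms])

lemma const_mat_one [simp]: "const_mat (1\<^sub>m n) = 1\<^sub>m n"
  unfolding const_mat_def by (rule const_hom.mat_hom_one)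

lemma strictly_proper_const_mat_mult:
  assumes M: "M \<in> carrier_mat r k" and N: "N \<in> carrier_mat k c"
    and sp: "\<And>i j. i < k \<Longrightarrow> j < c \<Longrightarrow> strictly_proper (N $$ (i, j))" and ij: "i < r" "j < c"
  shows "strictly_proper ((const_mat M * N) $$ (i, j))"
  using M N ij
  by (auto simp: scalar_prod_def const_mat_def intro!: strictly_proper_sum strictly_proper_const_mult sp)

lemma strictly_proper_mult_const_mat:
  assumes M: "M \<in> carrier_mat k c" and N: "N \<in> carrier_mat r k"
    and sp: "\<And>i j. i < r \<Longrightarrow> j < k \<Longrightarrow> strictly_proper (N $$ (i, j))" and ij: "i < r" "j < c"
  shows "strictly_proper ((N * const_mat M) $$ (i, j))"
  using M N ij
  by (auto simp: scalar_prod_def const_mat_def mult.commute[of _ "to_fract _"]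
      intro!: strictly_proper_sum strictly_proper_const_mult sp)

lemma mat_inv_eqI:
  fixes M :: "'a :: field mat"
  assumes M: "M \<in> carrier_mat n n" and N: "N \<in> carrier_mat n n" and NM: "N * M = 1\<^sub>m n"
  shows "mat_inv M = N"
proof -
  have MN: "M * N = 1\<^sub>m n" using mat_mult_left_right_inverse[OF N M NM] .
  have "M \<in> Units (ring_mat TYPE('a) n undefined)"
    using M N NM MN by (auto simp: Units_def ring_mat_simps)
  then obtain X where X: "mat_inverse M = Some X"
    using mat_inverse(1)[OF M, of undefined] by (cases "mat_inverse M") auto
  from mat_inverse(2)[OF M this] have X': "X \<in> carrier_mat n n" "M * X = 1\<^sub>m n" by auto
  then have "N * (M * X) = X" using M N NM by (intro mat_inverse_cancel) auto
  then have "X = N" using X' N by simp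
  then show ?thesis by (simp add: mat_inv_def X)
qed

definition resolvent :: "nat \<Rightarrow> real mat \<Rightarrow> ratfun mat" where
  "resolvent n A = mat_inv (ratfun_s \<cdot>\<^sub>m 1\<^sub>m n - const_mat A)"

text \<open>Cramer's rule: the resolvent is the adjugate of \<open>s I - A\<close> divided by the characteristic
  polynomial. The adjugate has entries of degree below \<open>n\<close>, the characteristic polynomial has
  degree \<open>n\<close>.\<close>

lemma resolvent:
  assumes A: "A \<in> carrier_mat n n"
  shows resolvent_carrier: "resolvent n A \<in> carrier_mat n n"
    and resolvent_right: "(ratfun_s \<cdot>\<^sub>m 1\<^sub>m n - const_mat A) * resolvent n A = 1\<^sub>m n"
    and resolvent_strictly_proper:
      "i < n \<Longrightarrow> j < n \<Longrightarrow> strictly_proper (resolvent n A $$ (i, j))"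
proof -
  define P where "P = char_poly_matrix A"
  have P: "P \<in> carrier_mat n n" using A by (simp add: P_def)
  have d: "det P \<noteq> 0" "degree (det P) = n"
    using degree_monic_char_poly[OF A] by (auto simp: P_def char_poly_def)
  define N where "N = map_mat (\<lambda>p. to_fract p / to_fract (det P)) (adj_mat P)"
  have N: "N \<in> carrier_mat n n" using adj_mat(1)[OF P] by (simp add: N_def)
  have M: "ratfun_s \<cdot>\<^sub>m 1\<^sub>m n - const_mat A = map_mat to_fract P"
    using A by (intro eq_matI)
      (auto simp: P_def char_poly_matrix_def ratfun_s_def const_mat_def
        simp flip: to_fract_diff to_fract_uminus)
  have mP: "map_mat to_fract P \<in> carrier_mat n n" using P by simp
  have "N = (1 / to_fract (det P)) \<cdot>\<^sub>m map_mat to_fract (adj_mat P)"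
    by (auto simp: N_def)
  then have "N * map_mat to_fract P = (1 / to_fract (det P)) \<cdot>\<^sub>m map_mat to_fract (adj_mat P * P)"
    using adj_mat(1)[OF P] P
    by (simp add: mult_smult_assoc_mat[of _ n n _ n] to_fract_hom.mat_hom_mult[of _ n n _ n])
  also have "\<dots> = 1\<^sub>m n"
    unfolding adj_mat(3)[OF P] using d(1) by (auto simp: to_fract_hom.hom_mult)
  finally have NM: "N * map_mat to_fract P = 1\<^sub>m n" .
  have R: "resolvent n A = N"
    unfolding resolvent_def M using mat_inv_eqI[OF mP N NM] .
  show "resolvent n A \<in> carrier_mat n n" using R N by simp
  show "(ratfun_s \<cdot>\<^sub>m 1\<^sub>m n - const_mat A) * resolvent n A = 1\<^sub>m n"
    unfolding R M using mat_mult_left_right_inverse[OF N mP NM] .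
  assume ij: "i < n" "j < n"
  have "degree (det (mat_delete P j i)) \<le> 1 * (n - 1)"
  proof (rule degree_det_le)
    show "mat_delete P j i \<in> carrier_mat (n - 1) (n - 1)" using P by (auto simp: mat_delete_def)
    fix k l assume kl: "k < n - 1" "l < n - 1"
    have "degree (P $$ (a, b)) \<le> 1" if "a < n" "b < n" for a b
      using that A by (auto simp: P_def char_poly_matrix_def)
    then show "degree (mat_delete P j i $$ (k, l)) \<le> 1"
      using kl P ij by (auto simp: mat_delete_def)
  qed
  then have "degree (cofactor P j i) < n"
    using ij degree_mult_le[of "(-1) ^ (j + i)" "det (mat_delete P j i)"]
    by (cases "even (j + i)") (auto simp: cofactor_def)
  then show "strictly_proper (resolvent n A $$ (i, j))"
    unfolding strictly_proper_def R using ij P d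
    by (auto simp: N_def adj_mat_def)
qed

lemma transfer_function_eq:
  "transfer_function n A B C D = const_mat C * resolvent n A * const_mat B + const_mat D"
  by (simp add: transfer_function_def resolvent_def)

lemma resolvent_shift:
  assumes A: "A \<in> carrier_mat n n"
  shows "ratfun_s \<cdot>\<^sub>m resolvent n A = 1\<^sub>m n + const_mat A * resolvent n A"
proof -
  note R = resolvent_carrier[OF A]
  have "(ratfun_s \<cdot>\<^sub>m 1\<^sub>m n - const_mat A) * resolvent n A
      = ratfun_s \<cdot>\<^sub>m resolvent n A - const_mat A * resolvent n A"
    using A R by (subst minus_mult_distrib_mat[of _ n n]) (auto simp: mult_smult_assoc_mat[of _ n n _ n])
  then have "ratfun_s \<cdot>\<^sub>m resolvent n A - const_mat A * resolvent n A = 1\<^sub>m n"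
    using resolvent_right[OF A] by simp
  moreover have "ratfun_s \<cdot>\<^sub>m resolvent n A
      = (ratfun_s \<cdot>\<^sub>m resolvent n A - const_mat A * resolvent n A) + const_mat A * resolvent n A"
    using A R by (intro eq_matI) auto
  ultimately show ?thesis by simp
qed

text \<open>The difference of the constant parts is strictly proper, hence zero. This compares
  transfer functions at infinity without any notion of limit or expansion.\<close>

lemma strictly_proper_part_unique:
  assumes D: "D \<in> carrier_mat r c" "D' \<in> carrier_mat r c"
    and X: "X \<in> carrier_mat r c" "X' \<in> carrier_mat r c"
    and sp: "\<And>i j. i < r \<Longrightarrow> j < c \<Longrightarrow> strictly_proper (X $$ (i, j))"
      "\<And>i j. i < r \<Longrightarrow> j < c \<Longrightarrow> strictly_proper (X' $$ (i, j))"
    and eq: "const_mat D + X = const_mat D' + X'"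
  shows "D = D'" "X = X'"
proof -
  have "D $$ (i, j) = D' $$ (i, j) \<and> X $$ (i, j) = X' $$ (i, j)" if ij: "i < r" "j < c" for i j
  proof -
    let ?d = "D $$ (i, j)" and ?d' = "D' $$ (i, j)" and ?x = "X $$ (i, j)" and ?x' = "X' $$ (i, j)"
    have e: "to_fract [:?d:] + ?x = to_fract [:?d':] + ?x'"
      using arg_cong[OF eq, of "\<lambda>M. M $$ (i, j)"] ij D X by (simp add: const_mat_def)
    have "to_fract [:?d - ?d':] = to_fract [:?d:] - to_fract [:?d':]"
      by (rule const_hom.hom_minus)
    also have "\<dots> = ?x' + to_fract [:-1:] * ?x"
      using e by (simp add: const_hom.hom_uminus algebra_simps)
    finally have "strictly_proper (to_fract [:?d - ?d':])"
      using sp[OF ij] by (simp add: strictly_proper_add strictly_proper_const_mult)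
    then show ?thesis using e by (simp add: strictly_proper_const_iff)
  qed
  then show "D = D'" "X = X'" using D X by (auto intro!: eq_matI)
qed

text \<open>Multiplication by \<open>s\<close> peels off one Markov parameter: \<open>s C (s I - A)\<^sup>-\<^sup>1 B\<close> has constant part
  \<open>C B\<close> and strictly proper part \<open>C A (s I - A)\<^sup>-\<^sup>1 B\<close>, which is of the original form with \<open>C A\<close> for \<open>C\<close>.
  Induction with the uniqueness of this decomposition gives all of them.\<close>

lemma transfer_function_eq_imp_markov:
  assumes dims: "system_dims n m A B C D" and dims': "system_dims n' m A' B' C' D'"
    and eq: "transfer_function n A B C D = transfer_function n' A' B' C' D'"
  shows "D = D'" and "C * A ^\<^sub>m k * B = C' * A' ^\<^sub>m k * B'"
proof -
  define G where "G n A B C = const_mat C * resolvent n A * const_mat B" for n A B C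
  have car: "G n A B C \<in> carrier_mat m m"
    and sp: "i < m \<Longrightarrow> j < m \<Longrightarrow> strictly_proper (G n A B C $$ (i, j))"
    and shift: "ratfun_s \<cdot>\<^sub>m G n A B C = const_mat (C * B) + G n A B (C * A)"
    if A: "A \<in> carrier_mat n n" and B: "B \<in> carrier_mat n m" and C: "C \<in> carrier_mat m n"
    for n A B C i j
  proof -
    note R = resolvent_carrier[OF A]
    show "G n A B C \<in> carrier_mat m m" using A B C R by (simp add: G_def)
    have CR: "const_mat C * resolvent n A \<in> carrier_mat m n" using C R by simp
    show "i < m \<Longrightarrow> j < m \<Longrightarrow> strictly_proper (G n A B C $$ (i, j))"
      unfolding G_def
      by (rule strictly_proper_mult_const_mat[OF B CR])
        (rule strictly_proper_const_mat_mult[OF C R resolvent_strictly_proper[OF A]])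
    have "ratfun_s \<cdot>\<^sub>m G n A B C = const_mat C * (ratfun_s \<cdot>\<^sub>m resolvent n A) * const_mat B"
      unfolding G_def using B C R
      by (simp add: mult_smult_distrib[of _ m n] mult_smult_assoc_mat[of _ m n _ m])
    also have "\<dots> = const_mat C * const_mat B + const_mat C * (const_mat A * resolvent n A) * const_mat B"
      unfolding resolvent_shift[OF A] using A B C R
      by (simp add: mult_add_distrib_mat[of _ m n _ n] add_mult_distrib_mat[of _ m n _ _ m])
    also have "\<dots> = const_mat (C * B) + G n A B (C * A)"
      unfolding G_def using A B C R by (simp add: const_mat_mult[of _ m n] mat_assoc)
    finally show "ratfun_s \<cdot>\<^sub>m G n A B C = const_mat (C * B) + G n A B (C * A)" .
  qed
  have d: "A \<in> carrier_mat n n" "B \<in> carrier_mat n m" "C \<in> carrier_mat m n" "D \<in> carrier_mat m m"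
    and d': "A' \<in> carrier_mat n' n'" "B' \<in> carrier_mat n' m" "C' \<in> carrier_mat m n'" "D' \<in> carrier_mat m m"
    using dims dims' by (auto simp: system_dims_def)
  have e: "const_mat D + G n A B C = const_mat D' + G n' A' B' C'"
    using eq car[OF d(1-3)] car[OF d'(1-3)] d(4) d'(4)
    unfolding transfer_function_eq G_def by (simp add: comm_add_mat[of _ m m])
  note split = strictly_proper_part_unique[OF _ _ car car sp sp]
  show "D = D'"
    using split(1)[OF d(4) d'(4) d(1-3) d'(1-3) d(1-3) _ _ d'(1-3) _ _ e] by blast
  have step: "C * B = C' * B' \<and> G n A B (C * A) = G n' A' B' (C' * A')"
    if C: "C \<in> carrier_mat m n" and C': "C' \<in> carrier_mat m n'" and g: "G n A B C = G n' A' B' C'" for C C'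
  proof -
    have CB: "C * B \<in> carrier_mat m m" "C' * B' \<in> carrier_mat m m"
      and CA: "C * A \<in> carrier_mat m n" "C' * A' \<in> carrier_mat m n'" using C C' d d' by auto
    have "const_mat (C * B) + G n A B (C * A) = const_mat (C' * B') + G n' A' B' (C' * A')"
      using shift[OF d(1,2) C] shift[OF d'(1,2) C'] g by simp
    from split[OF CB d(1,2) CA(1) d'(1,2) CA(2) d(1,2) CA(1) _ _ d'(1,2) CA(2) _ _ this]
    show ?thesis by blast
  qed
  have g: "G n A B (C * A ^\<^sub>m k) = G n' A' B' (C' * A' ^\<^sub>m k)" for k
  proof (induction k)
    case 0
    show ?case
      using split(2)[OF d(4) d'(4) d(1-3) d'(1-3) d(1-3) _ _ d'(1-3) _ _ e] d d' by simp
  next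
    case (Suc k)
    have "C * A ^\<^sub>m k \<in> carrier_mat m n" "C' * A' ^\<^sub>m k \<in> carrier_mat m n'" using d d' by auto
    from step[OF this Suc] show ?case using d d' by (simp add: mat_assoc)
  qed
  have "C * A ^\<^sub>m k \<in> carrier_mat m n" "C' * A' ^\<^sub>m k \<in> carrier_mat m n'" using d d' by auto
  from step[OF this g] show "C * A ^\<^sub>m k * B = C' * A' ^\<^sub>m k * B'" by blast
qed


section \<open>Change of coordinates\<close>

lemma resolvent_similar:
  assumes A: "A \<in> carrier_mat n n" and T: "T \<in> carrier_mat n n" and S: "S \<in> carrier_mat n n"
    and ST: "S * T = 1\<^sub>m n"
  shows "resolvent n (S * A * T) = const_mat S * resolvent n A * const_mat T"
proof -
  note R = resolvent_carrier[OF A]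
  let ?M = "\<lambda>A. ratfun_s \<cdot>\<^sub>m 1\<^sub>m n - const_mat A"
  let ?N = "const_mat S * resolvent n A * const_mat T"
  have TS: "T * S = 1\<^sub>m n" using mat_mult_left_right_inverse[OF S T ST] .
  have cTS: "const_mat T * const_mat S = 1\<^sub>m n" "const_mat S * const_mat T = 1\<^sub>m n"
    using TS ST S T by (simp_all add: const_mat_mult[symmetric, of _ n n _ n])
  have M: "?M A \<in> carrier_mat n n" "?M (S * A * T) \<in> carrier_mat n n" using A S T by auto
  have "const_mat S * ?M A * const_mat T
      = ratfun_s \<cdot>\<^sub>m (const_mat S * const_mat T) - const_mat S * const_mat A * const_mat T"
    using A S T by (simp add: mult_minus_distrib_mat[of _ n n _ n] minus_mult_distrib_mat[of _ n n _ _ n]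
        mult_smult_distrib[of _ n n _ n] mult_smult_assoc_mat[of _ n n _ n])
  also have "\<dots> = ?M (S * A * T)"
    using A S T cTS by (simp add: const_mat_mult[of _ n n _ n])
  finally have eq: "?M (S * A * T) = const_mat S * ?M A * const_mat T" ..
  define L where "L = ?M A"
  have L: "L \<in> carrier_mat n n" using M(1) by (simp only: L_def)
  have RL: "resolvent n A * L = 1\<^sub>m n"
    using mat_mult_left_right_inverse[OF M(1) R resolvent_right[OF A]] by (simp only: L_def)
  have "?N * ?M (S * A * T) = 1\<^sub>m n"
    unfolding eq L_def[symmetric] using L R S T cTS
    by (simp add: mat_assoc mat_inverse_cancel[OF cTS(1)] mat_inverse_cancel[OF RL])
  then show ?thesis
    unfolding resolvent_def[of n "S * A * T"] using R S T M by (intro mat_inv_eqI) auto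
qed

lemma transfer_function_transform:
  assumes dims: "system_dims n m A B C D"
    and T: "T \<in> carrier_mat n n" "S \<in> carrier_mat n n" "S * T = 1\<^sub>m n"
    and K: "K \<in> carrier_mat m m" "J \<in> carrier_mat m m"
  shows "transfer_function n (S * A * T) (S * B * K) (J * C * T) (J * D * K)
    = const_mat J * transfer_function n A B C D * const_mat K"
proof -
  have d: "A \<in> carrier_mat n n" "B \<in> carrier_mat n m" "C \<in> carrier_mat m n" "D \<in> carrier_mat m m"
    using dims by (auto simp: system_dims_def)
  note R = resolvent_carrier[OF d(1)]
  have TS: "T * S = 1\<^sub>m n" using mat_mult_left_right_inverse[OF T(2,1,3)] .
  have cTS: "const_mat T * const_mat S = 1\<^sub>m n"
    using TS T by (simp add: const_mat_mult[symmetric, of _ n n _ n])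
  have "const_mat (J * C * T) * resolvent n (S * A * T) * const_mat (S * B * K)
      = const_mat J * (const_mat C * resolvent n A * const_mat B) * const_mat K"
    unfolding resolvent_similar[OF d(1) T] using d R T K
    by (simp add: const_mat_mult[of _ m n _ n] const_mat_mult[of _ m m _ n] const_mat_mult[of _ n m _ m]
        const_mat_mult[of _ n n _ m] mat_assoc mat_inverse_cancel[OF cTS])
  then show ?thesis
    unfolding transfer_function_eq using d R T K
    by (simp add: mult_add_distrib_mat[of _ m m _ m] add_mult_distrib_mat[of _ m m _ _ m]
        const_mat_mult[of _ m m _ m])
qed

lemma minimal_system_transform:
  assumes dims: "system_dims n m A B C D" and min: "minimal_system n m A B C"
    and T: "T \<in> carrier_mat n n" "S \<in> carrier_mat n n" "S * T = 1\<^sub>m n"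
    and K: "K \<in> carrier_mat m m" "J \<in> carrier_mat m m" "J * K = 1\<^sub>m m"
  shows "minimal_system n m (S * A * T) (S * B * K) (J * C * T)"
proof -
  have d: "A \<in> carrier_mat n n" "B \<in> carrier_mat n m" "C \<in> carrier_mat m n" "D \<in> carrier_mat m m"
    using dims by (auto simp: system_dims_def)
  have TS: "T * S = 1\<^sub>m n" and KJ: "K * J = 1\<^sub>m m"
    using mat_mult_left_right_inverse T K by blast+
  have pow: "(S * A * T) ^\<^sub>m k = S * A ^\<^sub>m k * T" for k
  proof (induction k)
    case (Suc k)
    have "(S * A * T) ^\<^sub>m Suc k = S * A ^\<^sub>m k * T * (S * A * T)" by (simp add: Suc)
    also have "\<dots> = S * A ^\<^sub>m Suc k * T"
      using d T by (simp add: mat_assoc mat_inverse_cancel[OF TS])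
    finally show ?case .
  qed (use d T in simp)
  have cancel: "v = 0\<^sub>v p" if "L *\<^sub>v v = 0\<^sub>v p" "M * L = 1\<^sub>m p" "L \<in> carrier_mat p p" "M \<in> carrier_mat p p"
    "v \<in> carrier_vec p" for L M :: "real mat" and v p
  proof -
    have "M *\<^sub>v (L *\<^sub>v v) = v"
      using that by (subst assoc_mult_mat_vec[symmetric, of _ p p _ p]) auto
    moreover have "M *\<^sub>v 0\<^sub>v p = 0\<^sub>v p" using that(4) by (intro eq_vecI) auto
    ultimately show ?thesis using that(1) by simp
  qed
  have "observable n m (S * A * T) (J * C * T)"
  proof (subst observable_iff, goal_cases)
    case 3
    show ?case
    proof (intro ballI impI)
      fix v assume v: "v \<in> carrier_vec n"
        and z: "\<forall>k<n. (J * C * T * (S * A * T) ^\<^sub>m k) *\<^sub>v v = 0\<^sub>v m"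
      have Tv: "T *\<^sub>v v \<in> carrier_vec n" using T v by simp
      have "(C * A ^\<^sub>m k) *\<^sub>v (T *\<^sub>v v) = 0\<^sub>v m" if "k < n" for k
      proof (rule cancel[of J _ _ K])
        have "J * C * T * (S * A * T) ^\<^sub>m k = J * (C * A ^\<^sub>m k) * T"
          unfolding pow using d T K by (simp add: mat_assoc mat_inverse_cancel[OF TS])
        then have "J * (C * A ^\<^sub>m k) * T *\<^sub>v v = 0\<^sub>v m" using z that by metis
        then show "J *\<^sub>v ((C * A ^\<^sub>m k) *\<^sub>v (T *\<^sub>v v)) = 0\<^sub>v m"
          using d T K v
          by (simp add: assoc_mult_mat_vec[of "J * (C * A ^\<^sub>m k)" m n T n]
              assoc_mult_mat_vec[of J m m "C * A ^\<^sub>m k" n])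
      qed (use K KJ mult_mat_vec_carrier[OF mult_carrier_mat[OF d(3) pow_carrier_mat[OF d(1)]] Tv] in auto)
      then have "T *\<^sub>v v = 0\<^sub>v n"
        using min Tv d(1,3) unfolding minimal_system_def by (simp add: observable_iff)
      then show "v = 0\<^sub>v n" by (rule cancel[OF _ T(3) T(1,2) v])
    qed
  qed (use d T K in auto)
  moreover have "controllable n m (S * A * T) (S * B * K)"
  proof (subst controllable_iff, goal_cases)
    case 3
    have tr: "T\<^sup>T * S\<^sup>T = 1\<^sub>m n" "J\<^sup>T * K\<^sup>T = 1\<^sub>m m"
      using T K KJ by (simp_all add: transpose_mult[symmetric, of _ n n _ n] transpose_mult[symmetric, of _ m m _ m])
    show ?case
    proof (intro ballI impI)
      fix w assume w: "w \<in> carrier_vec n"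
        and z: "\<forall>k<n. ((S * A * T) ^\<^sub>m k * (S * B * K))\<^sup>T *\<^sub>v w = 0\<^sub>v m"
      have Sw: "S\<^sup>T *\<^sub>v w \<in> carrier_vec n" using T w by simp
      have "(A ^\<^sub>m k * B)\<^sup>T *\<^sub>v (S\<^sup>T *\<^sub>v w) = 0\<^sub>v m" if "k < n" for k
      proof (rule cancel[of "K\<^sup>T" _ _ "J\<^sup>T"])
        have "(S * A * T) ^\<^sub>m k * (S * B * K) = S * (A ^\<^sub>m k * B) * K"
          unfolding pow using d T K by (simp add: mat_assoc mat_inverse_cancel[OF TS])
        also have "\<dots>\<^sup>T = K\<^sup>T * ((A ^\<^sub>m k * B)\<^sup>T * S\<^sup>T)"
          using d T K by (simp add: transpose_mult[of "S * (A ^\<^sub>m k * B)" n m K m]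
              transpose_mult[of S n n "A ^\<^sub>m k * B" m])
        finally have "K\<^sup>T * ((A ^\<^sub>m k * B)\<^sup>T * S\<^sup>T) *\<^sub>v w = 0\<^sub>v m" using z that by metis
        moreover have AB: "(A ^\<^sub>m k * B)\<^sup>T \<in> carrier_mat m n" and Kt: "K\<^sup>T \<in> carrier_mat m m"
          and St: "S\<^sup>T \<in> carrier_mat n n" using d T K by simp_all
        ultimately show "K\<^sup>T *\<^sub>v ((A ^\<^sub>m k * B)\<^sup>T *\<^sub>v (S\<^sup>T *\<^sub>v w)) = 0\<^sub>v m"
          by (simp only: assoc_mult_mat_vec[OF Kt mult_carrier_mat[OF AB St] w] assoc_mult_mat_vec[OF AB St w])
      qed (use K tr mult_mat_vec_carrier[of "(A ^\<^sub>m k * B)\<^sup>T" m n] d Sw in auto)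
      then have "S\<^sup>T *\<^sub>v w = 0\<^sub>v n"
        using min Sw d(1,2) unfolding minimal_system_def by (simp add: controllable_iff)
      then show "w = 0\<^sub>v n" by (rule cancel[OF _ tr(1)]) (use T w in auto)
    qed
  qed (use d T K in auto)
  ultimately show ?thesis by (simp add: minimal_system_def)
qed


section \<open>Factorization of positive definite matrices\<close>

lemma quadratic_form_sum:
  fixes Q :: "real mat"
  assumes "Q \<in> carrier_mat k k" "v \<in> carrier_vec k"
  shows "v \<bullet> (Q *\<^sub>v v) = (\<Sum>i<k. \<Sum>j<k. v $ i * Q $$ (i, j) * v $ j)"
  using assms
  by (auto simp: scalar_prod_def atLeast0LessThan sum_distrib_left mult.assoc intro!: sum.cong)

text \<open>Induction on the size by the Schur complement \<open>S\<close> of the first diagonal entry. For a vector \<open>w\<close>, the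
  first coordinate \<open>a\<close> that minimizes the quadratic form of \<open>Q\<close> at \<open>(a, w)\<close> makes it equal to that
  of \<open>S\<close> at \<open>w\<close>, so \<open>S\<close> inherits positivity.\<close>

lemma sym_pos_def_cholesky:
  assumes "sym_pos_def k Q"
  shows "\<exists>L \<in> carrier_mat k k. Q = L * L\<^sup>T"
  using assms
proof (induction k arbitrary: Q)
  case 0
  then have "Q = 0\<^sub>m 0 0 * (0\<^sub>m 0 0)\<^sup>T" by (intro eq_matI) (auto simp: sym_pos_def_def)
  then show ?case by (intro bexI[of _ "0\<^sub>m 0 0"]) auto
next
  case (Suc k)
  have Q: "Q \<in> carrier_mat (Suc k) (Suc k)" and Qt: "Q\<^sup>T = Q"
    and pos: "\<And>v. v \<in> carrier_vec (Suc k) \<Longrightarrow> v \<noteq> 0\<^sub>v (Suc k) \<Longrightarrow> v \<bullet> (Q *\<^sub>v v) > 0"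
    using Suc.prems by (auto simp: sym_pos_def_def)
  have sym: "Q $$ (i, j) = Q $$ (j, i)" if "i < Suc k" "j < Suc k" for i j
    using arg_cong[OF Qt, of "\<lambda>M. M $$ (j, i)"] that Q by simp
  define q where "q = Q $$ (0, 0)"
  define c where "c = (\<lambda>i. Q $$ (Suc i, 0))"
  have q: "q > 0"
    using pos[of "unit_vec (Suc k) 0"] Q by (simp add: q_def)
  define S where "S = mat k k (\<lambda>(i, j). Q $$ (Suc i, Suc j) - c i * c j / q)"
  have "sym_pos_def k S"
    unfolding sym_pos_def_def
  proof (intro conjI ballI impI)
    show "S \<in> carrier_mat k k" by (simp add: S_def)
    show "S\<^sup>T = S" using sym by (intro eq_matI) (auto simp: S_def)
    fix w :: "real vec" assume w: "w \<in> carrier_vec k" "w \<noteq> 0\<^sub>v k"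
    define W where "W = (\<Sum>i<k. c i * w $ i)"
    \<comment> \<open>the minimizer of \<open>q a\<^sup>2 + 2 a W\<close>\<close>
    define a where "a = - W / q"
    define v where "v = vCons a w"
    have v: "v \<in> carrier_vec (Suc k)" "v \<noteq> 0\<^sub>v (Suc k)"
      using w by (auto simp: v_def zero_vec_Suc)
    let ?H = "\<Sum>i<k. \<Sum>j<k. w $ i * Q $$ (Suc i, Suc j) * w $ j"
    have "v \<bullet> (Q *\<^sub>v v) = a * q * a + (\<Sum>j<k. a * c j * w $ j)
        + (\<Sum>i<k. w $ i * c i * a + (\<Sum>j<k. w $ i * Q $$ (Suc i, Suc j) * w $ j))"
      unfolding quadratic_form_sum[OF Q v(1)]
      by (simp add: sum.lessThan_Suc_shift v_def q_def c_def sym[of 0 "Suc _"] del: sum.lessThan_Suc)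
    also have "\<dots> = a * q * a + 2 * (a * W) + ?H"
      by (simp add: W_def sum.distrib sum_distrib_left mult_ac)
    also have "\<dots> = ?H - W * W / q"
      using q by (simp add: a_def field_simps)
    finally have "v \<bullet> (Q *\<^sub>v v) = ?H - W * W / q" .
    moreover have "w \<bullet> (S *\<^sub>v w) = ?H - W * W / q"
    proof -
      have "w \<bullet> (S *\<^sub>v w) = (\<Sum>i<k. \<Sum>j<k. w $ i * Q $$ (Suc i, Suc j) * w $ j
          - (c i * w $ i) * (c j * w $ j) / q)"
        using w by (subst quadratic_form_sum[of _ k])
          (auto simp: S_def field_simps intro!: sum.cong)
      also have "\<dots> = ?H - W * W / q"
        by (simp add: W_def sum_subtractf sum_product sum_divide_distrib)
      finally show ?thesis .
    qed
    ultimately show "w \<bullet> (S *\<^sub>v w) > 0" using pos[OF v] by simp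
  qed
  from Suc.IH[OF this] obtain M where M: "M \<in> carrier_mat k k" "S = M * M\<^sup>T" by blast
  define L where "L = mat (Suc k) (Suc k) (\<lambda>(i, j).
    if j = 0 then Q $$ (i, 0) / sqrt q else if i = 0 then 0 else M $$ (i - 1, j - 1))"
  have "Q = L * L\<^sup>T"
  proof (rule eq_matI)
    fix i j assume "i < dim_row (L * L\<^sup>T)" "j < dim_col (L * L\<^sup>T)"
    then have ij: "i < Suc k" "j < Suc k" by (simp_all add: L_def)
    have "(L * L\<^sup>T) $$ (i, j) = (\<Sum>l<Suc k. L $$ (i, l) * L $$ (j, l))"
      using ij by (simp add: L_def scalar_prod_def atLeast0LessThan del: sum.lessThan_Suc)
    also have "\<dots> = Q $$ (i, 0) * Q $$ (j, 0) / q + (\<Sum>l<k. L $$ (i, Suc l) * L $$ (j, Suc l))"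
      unfolding sum.lessThan_Suc_shift using ij q by (simp add: L_def field_simps)
    also have "\<dots> = Q $$ (i, j)"
    proof (cases "i = 0 \<or> j = 0")
      case True
      then have "(\<Sum>l<k. L $$ (i, Suc l) * L $$ (j, Suc l)) = 0"
        using ij by (intro sum.neutral) (auto simp: L_def)
      moreover have "Q $$ (i, 0) * Q $$ (j, 0) / q = Q $$ (i, j)"
        using True q sym[of 0 j] ij by (auto simp: q_def)
      ultimately show ?thesis by simp
    next
      case False
      then obtain i' j' where s: "i = Suc i'" "j = Suc j'" using not0_implies_Suc by blast
      have "(\<Sum>l<k. L $$ (i, Suc l) * L $$ (j, Suc l)) = (M * M\<^sup>T) $$ (i', j')"
        using M(1) ij s by (simp add: L_def scalar_prod_def atLeast0LessThan)
      also have "\<dots> = Q $$ (i, j) - c i' * c j' / q"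
        using ij s by (simp add: M(2)[symmetric] S_def)
      finally show ?thesis by (simp add: s c_def)
    qed
    finally show "Q $$ (i, j) = (L * L\<^sup>T) $$ (i, j)" ..
  qed (use Q in \<open>auto simp: L_def\<close>)
  then show ?case by (intro bexI[of _ L]) (auto simp: L_def)
qed

lemma sym_pos_def_factorization:
  assumes spd: "sym_pos_def k Q"
  obtains L M where "L \<in> carrier_mat k k" "M \<in> carrier_mat k k" "M * L = 1\<^sub>m k" "Q = L * L\<^sup>T"
proof -
  from sym_pos_def_cholesky[OF spd] obtain L where L: "L \<in> carrier_mat k k" "Q = L * L\<^sup>T" by blast
  have Q: "Q \<in> carrier_mat k k" using spd by (simp add: sym_pos_def_def)
  have "v = 0\<^sub>v k" if "v \<in> carrier_vec k" "Q *\<^sub>v v = 0\<^sub>v k" for v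
    using spd that by (force simp: sym_pos_def_def)
  then obtain N where N: "N \<in> carrier_mat k k" "Q * N = 1\<^sub>m k"
    using trivial_kernel_imp_inverse[OF Q] by blast
  have "L * (L\<^sup>T * N) = 1\<^sub>m k" using N L by (simp add: mat_assoc)
  from mat_mult_left_right_inverse[OF L(1) _ this] show ?thesis
    using that[OF L(1) _ _ L(2), of "L\<^sup>T * N"] L N by auto
qed

lemma sym_pos_def_gram:
  assumes T: "T \<in> carrier_mat k k" and S: "S \<in> carrier_mat k k" and ST: "S * T = 1\<^sub>m k"
  shows "sym_pos_def k (T * T\<^sup>T)"
  unfolding sym_pos_def_def
proof (intro conjI ballI impI)
  show "T * T\<^sup>T \<in> carrier_mat k k" using T by simp
  show "(T * T\<^sup>T)\<^sup>T = T * T\<^sup>T" using T by (simp add: transpose_mult[of _ k k _ k])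
  fix v :: "real vec" assume v: "v \<in> carrier_vec k" "v \<noteq> 0\<^sub>v k"
  have TS: "T * S = 1\<^sub>m k" using mat_mult_left_right_inverse[OF S T ST] .
  let ?u = "T\<^sup>T *\<^sub>v v"
  have u: "?u \<in> carrier_vec k" using T v by simp
  have "S\<^sup>T * T\<^sup>T = 1\<^sub>m k" using transpose_mult[OF T S] TS by simp
  then have "S\<^sup>T *\<^sub>v ?u = v"
    using S T v by (subst assoc_mult_mat_vec[symmetric, of _ k k _ k]) auto
  moreover have "S\<^sup>T *\<^sub>v 0\<^sub>v k = 0\<^sub>v k" using S by (intro eq_vecI) auto
  ultimately have "?u \<noteq> 0\<^sub>v k" using v by metis
  then have "?u \<bullet> ?u > 0"
    using conjugate_square_greater_0_vec[OF u] by simp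
  moreover have "v \<bullet> ((T * T\<^sup>T) *\<^sub>v v) = ?u \<bullet> ?u"
  proof -
    have "(T * T\<^sup>T) *\<^sub>v v = T *\<^sub>v ?u" using T v by (intro assoc_mult_mat_vec[of _ k k _ k]) auto
    then have "v \<bullet> ((T * T\<^sup>T) *\<^sub>v v) = (T *\<^sub>v ?u) \<bullet> v"
      using comm_scalar_prod[of v k "T *\<^sub>v ?u"] T v by simp
    also have "\<dots> = ?u \<bullet> ?u"
      using transpose_vec_mult_scalar[OF T u v(1)] comm_scalar_prod[of v k "T *\<^sub>v ?u"] T v by simp
    finally show ?thesis .
  qed
  ultimately show "v \<bullet> ((T * T\<^sup>T) *\<^sub>v v) > 0" by simp
qed


section \<open>Feasibility as existence of a symmetrizing block-diagonal similarity\<close>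

lemma four_block_mat_eqD:
  assumes "four_block_mat A B C D = four_block_mat A' B' C' D'"
    and "A \<in> carrier_mat n1 m1" "B \<in> carrier_mat n1 m2" "C \<in> carrier_mat n2 m1" "D \<in> carrier_mat n2 m2"
    and "A' \<in> carrier_mat n1 m1" "B' \<in> carrier_mat n1 m2" "C' \<in> carrier_mat n2 m1" "D' \<in> carrier_mat n2 m2"
  shows "A = A'" "B = B'" "C = C'" "D = D'"
proof -
  have e: "four_block_mat A B C D $$ (i, j) = four_block_mat A' B' C' D' $$ (i, j)" for i j
    using assms(1) by simp
  show "A = A'"
  proof (rule eq_matI)
    fix i j assume "i < dim_row A'" "j < dim_col A'"
    then show "A $$ (i, j) = A' $$ (i, j)" using e[of i j] assms(2-) by simp
  qed (use assms in auto)
  show "B = B'"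
  proof (rule eq_matI)
    fix i j assume "i < dim_row B'" "j < dim_col B'"
    then show "B $$ (i, j) = B' $$ (i, j)" using e[of i "m1 + j"] assms(2-) by simp
  qed (use assms in auto)
  show "C = C'"
  proof (rule eq_matI)
    fix i j assume "i < dim_row C'" "j < dim_col C'"
    then show "C $$ (i, j) = C' $$ (i, j)" using e[of "n1 + i" j] assms(2-) by simp
  qed (use assms in auto)
  show "D = D'"
  proof (rule eq_matI)
    fix i j assume "i < dim_row D'" "j < dim_col D'"
    then show "D $$ (i, j) = D' $$ (i, j)" using e[of "n1 + i" "m1 + j"] assms(2-) by simp
  qed (use assms in auto)
qed

text \<open>Positivity of \<open>U\<close> and of \<open>V\<close> is that of the whole matrix at \<open>(u, 0)\<close> and at \<open>(0, v)\<close>.\<close>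

lemma sym_pos_def_diagonal_blocks:
  assumes spd: "sym_pos_def (n + m) (four_block_mat U (0\<^sub>m n m) (0\<^sub>m m n) V)"
    and U: "U \<in> carrier_mat n n" and V: "V \<in> carrier_mat m m"
  shows "sym_pos_def n U" "sym_pos_def m V"
proof -
  let ?Q = "four_block_mat U (0\<^sub>m n m) (0\<^sub>m m n) V"
  have "?Q\<^sup>T = ?Q" using spd by (simp add: sym_pos_def_def)
  then have "four_block_mat U\<^sup>T (0\<^sub>m n m) (0\<^sub>m m n) V\<^sup>T = ?Q"
    using transpose_four_block_mat[OF U _ _ V, of "0\<^sub>m n m" "0\<^sub>m m n"] by simp
  from four_block_mat_eqD[OF this] have sym: "U\<^sup>T = U" "V\<^sup>T = V" using U V by auto
  have app: "u @\<^sub>v v \<noteq> 0\<^sub>v (n + m) \<Longrightarrow> u \<bullet> (U *\<^sub>v u) + v \<bullet> (V *\<^sub>v v) > 0"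
    if u: "u \<in> carrier_vec n" and v: "v \<in> carrier_vec m" for u v
  proof -
    assume nz: "u @\<^sub>v v \<noteq> 0\<^sub>v (n + m)"
    have z: "0\<^sub>m n m *\<^sub>v v = 0\<^sub>v n" "0\<^sub>m m n *\<^sub>v u = 0\<^sub>v m"
      using u v by (auto intro!: eq_vecI)
    have "?Q *\<^sub>v (u @\<^sub>v v) = (U *\<^sub>v u) @\<^sub>v (V *\<^sub>v v)"
      using four_block_mat_mult_vec[OF U _ _ V u v, of "0\<^sub>m n m" "0\<^sub>m m n"] U V u v z by simp
    moreover have "(u @\<^sub>v v) \<bullet> (?Q *\<^sub>v (u @\<^sub>v v)) > 0"
      using spd u v nz by (simp add: sym_pos_def_def)
    ultimately show ?thesis
      using scalar_prod_append[OF u v, of "U *\<^sub>v u" "V *\<^sub>v v"] U V u v by simp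
  qed
  have first: "u = 0\<^sub>v n" "v = 0\<^sub>v m" if "u @\<^sub>v v = 0\<^sub>v (n + m)" "u \<in> carrier_vec n" "v \<in> carrier_vec m"
    for u v :: "real vec"
  proof -
    have "u @\<^sub>v v = 0\<^sub>v n @\<^sub>v 0\<^sub>v m" using that by (intro eq_vecI) auto
    then show "u = 0\<^sub>v n" "v = 0\<^sub>v m" using append_vec_eq[OF that(2), of "0\<^sub>v n" v "0\<^sub>v m"] by auto
  qed
  show "sym_pos_def n U"
    unfolding sym_pos_def_def
  proof (intro conjI ballI impI)
    fix u :: "real vec" assume u: "u \<in> carrier_vec n" "u \<noteq> 0\<^sub>v n"
    show "u \<bullet> (U *\<^sub>v u) > 0" using app[OF u(1), of "0\<^sub>v m"] first(1)[of u "0\<^sub>v m"] u V by auto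
  qed (use U sym in auto)
  show "sym_pos_def m V"
    unfolding sym_pos_def_def
  proof (intro conjI ballI impI)
    fix v :: "real vec" assume v: "v \<in> carrier_vec m" "v \<noteq> 0\<^sub>v m"
    show "v \<bullet> (V *\<^sub>v v) > 0" using app[OF _ v(1), of "0\<^sub>v n"] first(2)[of "0\<^sub>v n" v] v U by auto
  qed (use V sym in auto)
qed

lemma block_row_upper_right:
  assumes "Q1 \<in> carrier_mat n n" "Q2 \<in> carrier_mat n m" "Q3 \<in> carrier_mat m n" "Q4 \<in> carrier_mat m m"
  shows "block_row (1\<^sub>m n) (0\<^sub>m n m) * four_block_mat Q1 Q2 Q3 Q4 * (block_row (0\<^sub>m m n) (1\<^sub>m m))\<^sup>T = Q2"
proof -
  have "block_row (1\<^sub>m n) (0\<^sub>m n m) * four_block_mat Q1 Q2 Q3 Q4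
      = four_block_mat Q1 Q2 (0\<^sub>m 0 n) (0\<^sub>m 0 m)"
    unfolding block_row_def using assms
    by (subst mult_four_block_mat[where ?nr1.0 = n and ?nr2.0 = 0 and ?n1.0 = n and ?n2.0 = m
          and ?nc1.0 = n and ?nc2.0 = m]) auto
  moreover have "(block_row (0\<^sub>m m n) (1\<^sub>m m :: real mat))\<^sup>T
      = four_block_mat (0\<^sub>m n m) (0\<^sub>m n 0) (1\<^sub>m m) (0\<^sub>m m 0)"
    unfolding block_row_def
    by (subst transpose_four_block_mat[where ?nr1.0 = m and ?nr2.0 = 0 and ?nc1.0 = n and ?nc2.0 = m]) auto
  moreover have "four_block_mat Q1 Q2 (0\<^sub>m 0 n) (0\<^sub>m 0 m)
      * four_block_mat (0\<^sub>m n m) (0\<^sub>m n 0) (1\<^sub>m m) (0\<^sub>m m 0)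
      = four_block_mat Q2 (0\<^sub>m n 0) (0\<^sub>m 0 m) (0\<^sub>m 0 0)"
    using assms
    by (subst mult_four_block_mat[where ?nr1.0 = n and ?nr2.0 = 0 and ?n1.0 = n and ?n2.0 = m
          and ?nc1.0 = m and ?nc2.0 = 0]) auto
  moreover have "four_block_mat Q2 (0\<^sub>m n 0) (0\<^sub>m 0 m) (0\<^sub>m 0 0) = Q2"
    using assms by (intro eq_matI) auto
  ultimately show ?thesis by simp
qed

abbreviation block_diag :: "nat \<Rightarrow> nat \<Rightarrow> real mat \<Rightarrow> real mat \<Rightarrow> real mat" where
  "block_diag n m T K \<equiv> four_block_mat T (0\<^sub>m n m) (0\<^sub>m m n) K"

lemma block_diag_mult:
  assumes "T \<in> carrier_mat n n" "K \<in> carrier_mat m m" "T' \<in> carrier_mat n n" "K' \<in> carrier_mat m m"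
  shows "block_diag n m T K * block_diag n m T' K' = block_diag n m (T * T') (K * K')"
  using assms by (subst mult_four_block_mat[where ?nr1.0 = n and ?nr2.0 = m and ?n1.0 = n and ?n2.0 = m
          and ?nc1.0 = n and ?nc2.0 = m]) auto

lemma block_diag_transpose:
  assumes "T \<in> carrier_mat n n" "K \<in> carrier_mat m m"
  shows "(block_diag n m T K)\<^sup>T = block_diag n m T\<^sup>T K\<^sup>T"
  using assms by (subst transpose_four_block_mat[where ?nr1.0 = n and ?nr2.0 = m and ?nc1.0 = n and ?nc2.0 = m]) auto

text \<open>Since \<open>P L = L R\<close>, the two sides of the equation are \<open>L R L\<^sup>T\<close> and \<open>L R\<^sup>T L\<^sup>T\<close>, and
  the invertible outer factors cancel.\<close>

lemma congruence_symmetric_iff: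
  fixes P :: "real mat"
  assumes P: "P \<in> carrier_mat k k" and R: "R \<in> carrier_mat k k"
    and L: "L \<in> carrier_mat k k" and M: "M \<in> carrier_mat k k" and inv: "M * L = 1\<^sub>m k"
    and PL: "P * L = L * R"
  shows "P * (L * L\<^sup>T) = (L * L\<^sup>T) * P\<^sup>T \<longleftrightarrow> R\<^sup>T = R"
proof -
  have "P * (L * L\<^sup>T) = P * L * L\<^sup>T" using P L by (simp add: mat_assoc)
  then have a: "P * (L * L\<^sup>T) = L * (R * L\<^sup>T)"
    unfolding PL using R L by (simp add: mat_assoc)
  have "L\<^sup>T * P\<^sup>T = R\<^sup>T * L\<^sup>T"
    using transpose_mult[OF P L] transpose_mult[OF L R] PL by simp
  then have b: "(L * L\<^sup>T) * P\<^sup>T = L * (R\<^sup>T * L\<^sup>T)"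
    using P R L by (simp add: mat_assoc)
  have LM: "L\<^sup>T * M\<^sup>T = 1\<^sub>m k" using transpose_mult[OF M L] inv by simp
  have "R\<^sup>T = R" if e: "L * (R * L\<^sup>T) = L * (R\<^sup>T * L\<^sup>T)"
  proof -
    have "M * (L * (R * L\<^sup>T)) = M * (L * (R\<^sup>T * L\<^sup>T))" using e by simp
    then have "R * L\<^sup>T = R\<^sup>T * L\<^sup>T" using L M R by (simp add: mat_inverse_cancel[OF inv])
    then have "R * L\<^sup>T * M\<^sup>T = R\<^sup>T * L\<^sup>T * M\<^sup>T" by simp
    then show ?thesis using L M R LM by (simp add: mat_assoc)
  qed
  then show ?thesis unfolding a b by auto
qed

lemma sdp_feasibleI:
  assumes P: "P \<in> carrier_mat (n + m) (n + m)" and R: "R \<in> carrier_mat (n + m) (n + m)"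
    and T: "T \<in> carrier_mat n n" "S \<in> carrier_mat n n" "S * T = 1\<^sub>m n"
    and K: "K \<in> carrier_mat m m" "J \<in> carrier_mat m m" "J * K = 1\<^sub>m m"
    and PL: "P * block_diag n m T K = block_diag n m T K * R" and sym: "R\<^sup>T = R"
  shows "sdp_feasible n m P"
proof -
  let ?L = "block_diag n m T K" and ?M = "block_diag n m S J"
  have c: "?L \<in> carrier_mat (n + m) (n + m)" "?M \<in> carrier_mat (n + m) (n + m)"
    using T K by auto
  have inv: "?M * ?L = 1\<^sub>m (n + m)" using T K by (simp add: block_diag_mult)
  have "?L * ?L\<^sup>T = block_diag n m (T * T\<^sup>T) (K * K\<^sup>T)"
    using T K by (simp add: block_diag_mult block_diag_transpose)
  then have "block_row (1\<^sub>m n) (0\<^sub>m n m) * (?L * ?L\<^sup>T) * (block_row (0\<^sub>m m n) (1\<^sub>m m))\<^sup>T = 0\<^sub>m n m"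
    using block_row_upper_right[of "T * T\<^sup>T" n "0\<^sub>m n m" m "0\<^sub>m m n" "K * K\<^sup>T"] T K by simp
  moreover have "P * (?L * ?L\<^sup>T) = ?L * ?L\<^sup>T * P\<^sup>T"
    using congruence_symmetric_iff[OF P R c inv PL] sym by simp
  moreover have "sym_pos_def (n + m) (?L * ?L\<^sup>T)" by (rule sym_pos_def_gram[OF c inv])
  ultimately show ?thesis
    unfolding sdp_feasible_def by (intro bexI[of _ "?L * ?L\<^sup>T"]) (auto simp: sym_pos_def_def)
qed

lemma sdp_feasibleE:
  assumes sdp: "sdp_feasible n m P" and P: "P \<in> carrier_mat (n + m) (n + m)"
  obtains T S K J where "T \<in> carrier_mat n n" "S \<in> carrier_mat n n" "S * T = 1\<^sub>m n"
    "K \<in> carrier_mat m m" "J \<in> carrier_mat m m" "J * K = 1\<^sub>m m"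
    "(block_diag n m S J * P * block_diag n m T K)\<^sup>T = block_diag n m S J * P * block_diag n m T K"
proof -
  obtain Q where Q: "Q \<in> carrier_mat (n + m) (n + m)" and spd: "sym_pos_def (n + m) Q"
    and PQ: "P * Q = Q * P\<^sup>T"
    and off: "block_row (1\<^sub>m n) (0\<^sub>m n m) * Q * (block_row (0\<^sub>m m n) (1\<^sub>m m))\<^sup>T = 0\<^sub>m n m"
    using sdp unfolding sdp_feasible_def by blast
  obtain U Z W V where "split_block Q n n = (U, Z, W, V)" by (cases "split_block Q n n") auto
  from split_block[OF this] have b: "U \<in> carrier_mat n n" "Z \<in> carrier_mat n m"
    "W \<in> carrier_mat m n" "V \<in> carrier_mat m m" and Qb: "Q = four_block_mat U Z W V" using Q by auto
  have Z: "Z = 0\<^sub>m n m" using off block_row_upper_right[OF b] by (simp add: Qb)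
  have "Q\<^sup>T = Q" using spd by (simp add: sym_pos_def_def)
  then have "four_block_mat U\<^sup>T W\<^sup>T Z\<^sup>T V\<^sup>T = four_block_mat U Z W V"
    unfolding Qb using transpose_four_block_mat[OF b] by simp
  from four_block_mat_eqD(3)[OF this, of n n m m] have W: "W = 0\<^sub>m m n" using b Z by auto
  have Qd: "Q = block_diag n m U V" using Qb Z W by simp
  have UV: "sym_pos_def n U" "sym_pos_def m V"
    using sym_pos_def_diagonal_blocks[OF spd[unfolded Qd] b(1,4)] .
  obtain T S where T: "T \<in> carrier_mat n n" "S \<in> carrier_mat n n" "S * T = 1\<^sub>m n" "U = T * T\<^sup>T"
    using sym_pos_def_factorization[OF UV(1)] .
  obtain K J where K: "K \<in> carrier_mat m m" "J \<in> carrier_mat m m" "J * K = 1\<^sub>m m" "V = K * K\<^sup>T"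
    using sym_pos_def_factorization[OF UV(2)] .
  let ?L = "block_diag n m T K" and ?M = "block_diag n m S J"
  have c: "?L \<in> carrier_mat (n + m) (n + m)" "?M \<in> carrier_mat (n + m) (n + m)"
    using T K by auto
  have inv: "?M * ?L = 1\<^sub>m (n + m)" using T K by (simp add: block_diag_mult)
  have LM: "?L * ?M = 1\<^sub>m (n + m)" using mat_mult_left_right_inverse[OF c(2,1) inv] .
  have QL: "Q = ?L * ?L\<^sup>T"
    using T K by (simp add: block_diag_mult block_diag_transpose Qd)
  have R: "?M * P * ?L \<in> carrier_mat (n + m) (n + m)"
    using P c by (intro mult_carrier_mat[where n = "n + m"])
  have "?L * (?M * P * ?L) = ?L * (?M * (P * ?L))"
    using P c T K by (subst mat_assoc[of ?M P ?L]) auto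
  also have "\<dots> = P * ?L" using P c T K by (intro mat_inverse_cancel[OF LM]) auto
  finally have "P * ?L = ?L * (?M * P * ?L)" ..
  from congruence_symmetric_iff[OF P R c inv this] PQ[unfolded QL]
  have "(?M * P * ?L)\<^sup>T = ?M * P * ?L" by blast
  then show ?thesis using that[OF T(1-3) K(1-3)] by blast
qed

text \<open>The internal signature \<open>-I\<close> enters the block signature matrix with the opposite sign, so that the
  latter is the identity.\<close>

lemma internally_symmetric_complete_iff:
  assumes "system_dims n m A B C D"
  shows "internally_symmetric n m (- 1\<^sub>m n) (1\<^sub>m m) A B C D \<longleftrightarrow>
    (system_matrix A B C D)\<^sup>T = system_matrix A B C D"
proof -
  have P: "system_matrix A B C D \<in> carrier_mat (n + m) (n + m)"
    using assms by (auto simp: system_dims_def)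
  have "signature_mat n (- 1\<^sub>m n)" "signature_mat m (1\<^sub>m m)"
    by (auto simp: signature_mat_def diagonal_mat_def)
  moreover have "four_block_mat (- (- 1\<^sub>m n)) (0\<^sub>m n m) (0\<^sub>m m n) (1\<^sub>m m) = (1\<^sub>m (n + m) :: real mat)"
    by simp
  moreover have "1\<^sub>m (n + m) * system_matrix A B C D = system_matrix A B C D"
    using P by (rule left_mult_one_mat)
  moreover have "(system_matrix A B C D)\<^sup>T * 1\<^sub>m (n + m) = (system_matrix A B C D)\<^sup>T"
    using P by (intro right_mult_one_mat[of _ "n + m"]) simp
  ultimately show ?thesis unfolding internally_symmetric_def Let_def by auto
qed

lemma block_diag_mult_left:
  assumes "system_dims n m A B C D" "S \<in> carrier_mat n n" "J \<in> carrier_mat m m"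
  shows "block_diag n m S J * system_matrix A B C D = system_matrix (S * A) (S * B) (J * C) (J * D)"
  using assms by (subst mult_four_block_mat[where ?nr1.0 = n and ?nr2.0 = m and ?n1.0 = n and ?n2.0 = m
        and ?nc1.0 = n and ?nc2.0 = m]) (auto simp: system_dims_def)

lemma block_diag_mult_right:
  assumes "system_dims n m A B C D" "T \<in> carrier_mat n n" "K \<in> carrier_mat m m"
  shows "system_matrix A B C D * block_diag n m T K = system_matrix (A * T) (B * K) (C * T) (D * K)"
  using assms by (subst mult_four_block_mat[where ?nr1.0 = n and ?nr2.0 = m and ?n1.0 = n and ?n2.0 = m
        and ?nc1.0 = n and ?nc2.0 = m]) (auto simp: system_dims_def)


section \<open>Symmetrizability and the semidefinite program\<close>

theorem mainTheorem3:
  fixes n m :: nat and A B C D :: "real mat"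
  assumes "system_dims n m A B C D"
    and "minimal_system n m A B C"
  shows "symmetrizable m (transfer_function n A B C D) \<longleftrightarrow>
    sdp_feasible n m (system_matrix A B C D)"
proof
  let ?P = "system_matrix A B C D"
  note dims = assms(1) and min = assms(2)
  have d: "A \<in> carrier_mat n n" "B \<in> carrier_mat n m" "C \<in> carrier_mat m n" "D \<in> carrier_mat m m"
    using dims by (auto simp: system_dims_def)
  assume "symmetrizable m (transfer_function n A B C D)"
  then obtain K n' A' B' C' D' where K: "K \<in> carrier_mat m m" "invertible_mat K"
    and dims': "system_dims n' m A' B' C' D'"
    and tf: "const_mat (mat_inv K) * transfer_function n A B C D * const_mat K
      = transfer_function n' A' B' C' D'"
    and min': "minimal_system n' m A' B' C'"
    and sym': "internally_symmetric n' m (- 1\<^sub>m n') (1\<^sub>m m) A' B' C' D'"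
    unfolding symmetrizable_def completely_symmetric_def by blast
  have d': "A' \<in> carrier_mat n' n'" "B' \<in> carrier_mat n' m" "C' \<in> carrier_mat m n'" "D' \<in> carrier_mat m m"
    using dims' by (auto simp: system_dims_def)
  obtain J where J: "J \<in> carrier_mat m m" "J * K = 1\<^sub>m m"
  proof -
    obtain J where "inverts_mat K J" "inverts_mat J K"
      using K(2) unfolding invertible_mat_def by blast
    then have e: "K * J = 1\<^sub>m m" "J * K = 1\<^sub>m (dim_row J)" using K(1) by (auto simp: inverts_mat_def)
    have "dim_col J = m" "dim_row J = m"
      using arg_cong[OF e(1), of dim_col] arg_cong[OF e(2), of dim_col] K(1) by auto
    then show ?thesis using that[of J] e by auto
  qed
  have KJ: "K * J = 1\<^sub>m m" using mat_mult_left_right_inverse[OF J(1) K(1) J(2)] .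
  have inv: "mat_inv K = J" using mat_inv_eqI[OF K(1) J] .
  have dims1: "system_dims n m A (B * K) (J * C) (J * D * K)"
    using d K(1) J by (auto simp: system_dims_def)
  \<comment> \<open>the transformation results are applied with the identity on the state space\<close>
  have one: "1\<^sub>m n * A * 1\<^sub>m n = A" "1\<^sub>m n * B * K = B * K" "J * C * 1\<^sub>m n = J * C"
    using d J K(1) by simp_all
  have "minimal_system n m (1\<^sub>m n * A * 1\<^sub>m n) (1\<^sub>m n * B * K) (J * C * 1\<^sub>m n)"
    by (rule minimal_system_transform[OF dims min]) (use K(1) J in auto)
  then have min1: "minimal_system n m A (B * K) (J * C)" by (simp only: one)
  have "transfer_function n (1\<^sub>m n * A * 1\<^sub>m n) (1\<^sub>m n * B * K) (J * C * 1\<^sub>m n) (J * D * K)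
      = const_mat J * transfer_function n A B C D * const_mat K"
    by (rule transfer_function_transform[OF dims]) (use K(1) J in auto)
  then have "transfer_function n A (B * K) (J * C) (J * D * K) = transfer_function n' A' B' C' D'"
    by (simp only: one tf[unfolded inv])
  note markov = transfer_function_eq_imp_markov[OF dims1 dims' this]
  obtain S T where iso: "n' = n" "S \<in> carrier_mat n n" "T \<in> carrier_mat n n"
    "S * T = 1\<^sub>m n" "A * T = T * A'" "B * K = T * B'" "J * C * T = C'"
    using minimal_realizations_isomorphic[OF d(1) mult_carrier_mat[OF d(2) K(1)] mult_carrier_mat[OF J(1) d(3)]
        d'(1-3) min1 min' markov(2)] by blast
  let ?R = "system_matrix A' B' C' D'"
  have CT: "C * T = K * C'"
    unfolding iso(7)[symmetric] using d K(1) J iso(3) by (simp add: mat_assoc mat_inverse_cancel[OF KJ])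
  have DK: "D * K = K * D'"
    unfolding markov(1)[symmetric] using d K(1) J by (simp add: mat_assoc mat_inverse_cancel[OF KJ])
  have "?P * block_diag n m T K = block_diag n m T K * ?R"
    unfolding block_diag_mult_right[OF dims iso(3) K(1)]
      block_diag_mult_left[OF dims'[unfolded iso(1)] iso(3) K(1)]
    by (simp add: iso(5,6) CT DK)
  moreover have "?R\<^sup>T = ?R" using internally_symmetric_complete_iff[OF dims'] sym' by simp
  moreover have "?P \<in> carrier_mat (n + m) (n + m)" "?R \<in> carrier_mat (n + m) (n + m)"
    using d d' iso(1) by auto
  ultimately show "sdp_feasible n m ?P"
    using sdp_feasibleI[of ?P n m ?R T S K J] iso(2-4) K(1) J by blast
next
  let ?P = "system_matrix A B C D"
  note dims = assms(1) and min = assms(2)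
  have d: "A \<in> carrier_mat n n" "B \<in> carrier_mat n m" "C \<in> carrier_mat m n" "D \<in> carrier_mat m m"
    using dims by (auto simp: system_dims_def)
  assume sdp: "sdp_feasible n m ?P"
  have "?P \<in> carrier_mat (n + m) (n + m)" using d by auto
  from sdp_feasibleE[OF sdp this] obtain T S K J where T: "T \<in> carrier_mat n n" "S \<in> carrier_mat n n" "S * T = 1\<^sub>m n"
    and K: "K \<in> carrier_mat m m" "J \<in> carrier_mat m m" "J * K = 1\<^sub>m m"
    and sym: "(block_diag n m S J * ?P * block_diag n m T K)\<^sup>T = block_diag n m S J * ?P * block_diag n m T K"
    by blast
  have dims1: "system_dims n m (S * A) (S * B) (J * C) (J * D)"
    and dims2: "system_dims n m (S * A * T) (S * B * K) (J * C * T) (J * D * K)"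
    using d T K by (auto simp: system_dims_def)
  have "internally_symmetric n m (- 1\<^sub>m n) (1\<^sub>m m) (S * A * T) (S * B * K) (J * C * T) (J * D * K)"
    using sym unfolding internally_symmetric_complete_iff[OF dims2]
      block_diag_mult_left[OF dims T(2) K(2)] block_diag_mult_right[OF dims1 T(1) K(1)] .
  moreover have "minimal_system n m (S * A * T) (S * B * K) (J * C * T)"
    by (rule minimal_system_transform[OF dims min T K])
  moreover have "const_mat (mat_inv K) * transfer_function n A B C D * const_mat K
      = transfer_function n (S * A * T) (S * B * K) (J * C * T) (J * D * K)"
    using transfer_function_transform[OF dims T K(1,2)] mat_inv_eqI[OF K] by simp
  ultimately have "completely_symmetric m
      (const_mat (mat_inv K) * transfer_function n A B C D * const_mat K)"
    unfolding completely_symmetric_def using dims2 by blast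
  moreover have "invertible_mat K"
    unfolding invertible_mat_def inverts_mat_def
    using K mat_mult_left_right_inverse[OF K(2,1,3)] by auto
  ultimately show "symmetrizable m (transfer_function n A B C D)"
    unfolding symmetrizable_def using K(1) by blast
qed

end
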